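(* Let $p:\mathbb{D}\to\mathbb{E}$ be a functor between small categories, $\mathsf{K}$ an order enriched category and $J$ a subcategory of $\mathsf{K}$ containing all objects of $\mathsf{K}$. Assume: $J$ and $\mathsf{K}$ have all small coproducts and the inclusion $J\hookrightarrow\mathsf{K}$ preserves them; $\mathsf{K}$ is $\mathsf{Sup}$-enriched; and all suprema in hom-sets of $\mathsf{K}$ are preserved by arbitrary cotupling, i.e. $[\{\bigvee_{i_j}f_{i_j}\}_j]=\bigvee_{j,i_j}[\{f_{i_j}\}_j]$. Then the change-of-base functor $[p,\mathsf{K}]^J:[\mathbb{E},\mathsf{K}]^J\to[\mathbb{D},\mathsf{K}]^J$ admits a left 2-adjoint.
   Context: A lax functor $\pi:\mathbb{D}\to\mathsf{K}$ into an order enriched category (hom-sets posets, composition monotone) assigns objects to objects and morphisms to morphisms such that $id_{\pi D}\leq\pi(id_D)$ and $\pi(d_1)\circ\pi(d_2)\leq\pi(d_1\circ d_2)$. An oplax transformation $f:\pi\to\pi'$ is a family $f_D:\pi D\to\pi'D$ with $f_{D'}\circ\pi(d)\leq\pi'(d)\circ f_D$ for all $d:D\to D'$. $[\mathbb{D},\mathsf{K}]^J$ is the category of lax functors $\mathbb{D}\to\mathsf{K}$ and oplax transformations all of whose components lie in $J$, with hom-sets ordered componentwise ($f\leq f'$ iff $f_D\leq f'_D$ for all $D$). $\mathsf{K}$ is $\mathsf{Sup}$-enriched if every hom-set is a complete lattice and composition preserves arbitrary suprema in each variable. $[p,\mathsf{K}]^J$ sends $\pi$ to $\pi\circ p$ and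 an oplax transformation $f$ to the transformation with components $([p,\mathsf{K}]^J f)_D=f_{pD}$. A 2-adjunction is a pair of hom-order preserving functors $F:\mathsf{A}\to\mathsf{B}$, $U:\mathsf{B}\to\mathsf{A}$ with poset isomorphisms $\mathsf{B}(FX,Y)\cong\mathsf{A}(X,UY)$ natural in $X,Y$; $F$ is the left 2-adjoint. *)

theory Defs
  imports "HOL-Algebra.Complete_Lattice" "HOL-Library.FuncSet"
begin

section \<open>Categories and functors\<close>

record ('o, 'a) category =
  Obj :: "'o set"
  Arr :: "'a set"
  Dom :: "'a \<Rightarrow> 'o"
  Cod :: "'a \<Rightarrow> 'o"
  Idn :: "'o \<Rightarrow> 'a"
  Comp :: "'a \<Rightarrow> 'a \<Rightarrow> 'a" (infixl \<open>\<odot>\<index>\<close> 70)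

text \<open>Composition is written in the applicative order: \<open>g \<odot> f\<close> is \<open>g\<close> after \<open>f\<close>.
  It is only meaningful for composable arrows.\<close>

definition hom :: "('o, 'a, 'm) category_scheme \<Rightarrow> 'o \<Rightarrow> 'o \<Rightarrow> 'a set" where
  "hom C A B = {f \<in> Arr C. Dom C f = A \<and> Cod C f = B}"

locale category =
  fixes C (structure)
  assumes Dom_Obj: "f \<in> Arr C \<Longrightarrow> Dom C f \<in> Obj C"
    and Cod_Obj: "f \<in> Arr C \<Longrightarrow> Cod C f \<in> Obj C"
    and Idn_hom: "A \<in> Obj C \<Longrightarrow> Idn C A \<in> hom C A A"
    and Comp_hom: "\<lbrakk>f \<in> hom C X Y; g \<in> hom C Y Z\<rbrakk> \<Longrightarrow> g \<odot> f \<in> hom C X Z"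
    and Comp_Idn: "f \<in> hom C X Y \<Longrightarrow> f \<odot> Idn C X = f"
    and Idn_Comp: "f \<in> hom C X Y \<Longrightarrow> Idn C Y \<odot> f = f"
    and Comp_assoc: "\<lbrakk>f \<in> hom C W X; g \<in> hom C X Y; h \<in> hom C Y Z\<rbrakk>
                     \<Longrightarrow> (h \<odot> g) \<odot> f = h \<odot> (g \<odot> f)"

record ('o, 'a, 'p, 'b) cat_map =
  omap :: "'o \<Rightarrow> 'p"
  amap :: "'a \<Rightarrow> 'b"

locale cat_functor = C: category C + D: category D
  for C :: "('o, 'a, 'm) category_scheme" and D :: "('p, 'b, 'n) category_scheme" +
  fixes F :: "('o, 'a, 'p, 'b) cat_map"
  assumes omap_Obj: "A \<in> Obj C \<Longrightarrow> omap F A \<in> Obj D"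
    and amap_hom: "f \<in> hom C A B \<Longrightarrow> amap F f \<in> hom D (omap F A) (omap F B)"
    and amap_Idn: "A \<in> Obj C \<Longrightarrow> amap F (Idn C A) = Idn D (omap F A)"
    and amap_Comp: "\<lbrakk>f \<in> hom C X Y; g \<in> hom C Y Z\<rbrakk>
                    \<Longrightarrow> amap F (g \<odot>\<^bsub>C\<^esub> f) = amap F g \<odot>\<^bsub>D\<^esub> amap F f"

locale subcategory = J: category J + K: category K
  for J :: "('o, 'a, 'm) category_scheme" and K :: "('o, 'a, 'n) category_scheme" +
  assumes Obj_sub: "Obj J \<subseteq> Obj K"
    and Arr_sub: "Arr J \<subseteq> Arr K"
    and Dom_eq: "f \<in> Arr J \<Longrightarrow> Dom J f = Dom K f"
    and Cod_eq: "f \<in> Arr J \<Longrightarrow> Cod J f = Cod K f"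
    and Idn_eq: "A \<in> Obj J \<Longrightarrow> Idn J A = Idn K A"
    and Comp_eq: "\<lbrakk>f \<in> hom J X Y; g \<in> hom J Y Z\<rbrakk> \<Longrightarrow> g \<odot>\<^bsub>J\<^esub> f = g \<odot>\<^bsub>K\<^esub> f"


section \<open>Smallness and coproducts\<close>

text \<open>Smallness is relative to an arbitrary type \<open>'s\<close>: a set is small if it is in bijection with a
  set of elements of \<open>'s\<close>. The notions are polymorphic in \<open>'s\<close>, and nothing is required of it,
  so this covers smallness with respect to any universe or cardinal bound: given small categories
  in such a sense, take for \<open>'s\<close> a small type into which their objects and arrows embed.
  Up to bijection, the small families are those indexed by the sets \<open>I :: 's set\<close>.\<close>

definition small :: "'s itself \<Rightarrow> 'x set \<Rightarrow> bool" where
  "small (_ :: 's itself) A \<longleftrightarrow> (\<exists>i :: 'x \<Rightarrow> 's. inj_on i A)"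

definition small_category :: "'s itself \<Rightarrow> ('o, 'a, 'm) category_scheme \<Rightarrow> bool" where
  "small_category S C \<longleftrightarrow> category C \<and> small S (Obj C) \<and> small S (Arr C)"

definition is_coproduct ::
    "('o, 'a, 'm) category_scheme \<Rightarrow> 'i set \<Rightarrow> ('i \<Rightarrow> 'o) \<Rightarrow> 'o \<Rightarrow> ('i \<Rightarrow> 'a) \<Rightarrow> bool" where
  "is_coproduct C I X S \<iota> \<longleftrightarrow>
     (\<forall>i\<in>I. X i \<in> Obj C) \<and> S \<in> Obj C \<and> (\<forall>i\<in>I. \<iota> i \<in> hom C (X i) S) \<and>
     (\<forall>Y\<in>Obj C. \<forall>f. (\<forall>i\<in>I. f i \<in> hom C (X i) Y) \<longrightarrow>
        (\<exists>!h. h \<in> hom C S Y \<and> (\<forall>i\<in>I. h \<odot>\<^bsub>C\<^esub> \<iota> i = f i)))"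

text \<open>The cotuple \<open>[{f i}\<^sub>i] : S \<rightarrow> Y\<close> out of a coproduct \<open>S\<close> with injections \<open>\<iota>\<close>.\<close>

definition cotuple ::
    "('o, 'a, 'm) category_scheme \<Rightarrow> 'i set \<Rightarrow> 'o \<Rightarrow> ('i \<Rightarrow> 'a) \<Rightarrow> 'o \<Rightarrow> ('i \<Rightarrow> 'a) \<Rightarrow> 'a" where
  "cotuple C I S \<iota> Y f = (THE h. h \<in> hom C S Y \<and> (\<forall>i\<in>I. h \<odot>\<^bsub>C\<^esub> \<iota> i = f i))"

definition has_small_coproducts :: "'s itself \<Rightarrow> ('o, 'a, 'm) category_scheme \<Rightarrow> bool" where
  "has_small_coproducts (_ :: 's itself) C \<longleftrightarrow>
     (\<forall>(I :: 's set) X. (\<forall>i\<in>I. X i \<in> Obj C) \<longrightarrow> (\<exists>S \<iota>. is_coproduct C I X S \<iota>))"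

definition inclusion_preserves_small_coproducts ::
    "'s itself \<Rightarrow> ('o, 'a, 'm) category_scheme \<Rightarrow> ('o, 'a, 'n) category_scheme \<Rightarrow> bool" where
  "inclusion_preserves_small_coproducts (_ :: 's itself) J K \<longleftrightarrow>
     (\<forall>(I :: 's set) X S \<iota>. is_coproduct J I X S \<iota> \<longrightarrow> is_coproduct K I X S \<iota>)"


section \<open>Order enriched categories\<close>

record ('o, 'a) ocategory = "('o, 'a) category" +
  Leq :: "'a \<Rightarrow> 'a \<Rightarrow> bool" (infix \<open>\<preceq>\<index>\<close> 50)

definition hom_poset :: "('o, 'a, 'm) ocategory_scheme \<Rightarrow> 'o \<Rightarrow> 'o \<Rightarrow> 'a gorder" where
  "hom_poset K A B = \<lparr>carrier = hom K A B, eq = (=), le = Leq K\<rparr>"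

locale ordered_category = category K for K :: "('o, 'a, 'm) ocategory_scheme" (structure) +
  assumes hom_partial_order: "\<lbrakk>A \<in> Obj K; B \<in> Obj K\<rbrakk> \<Longrightarrow> partial_order (hom_poset K A B)"
    and Comp_mono: "\<lbrakk>f \<in> hom K X Y; f' \<in> hom K X Y; g \<in> hom K Y Z; g' \<in> hom K Y Z;
                     f \<preceq> f'; g \<preceq> g'\<rbrakk> \<Longrightarrow> g \<odot> f \<preceq> g' \<odot> f'"

locale sup_enriched_category = ordered_category +
  assumes hom_complete_lattice:
      "\<lbrakk>A \<in> Obj K; B \<in> Obj K\<rbrakk> \<Longrightarrow> complete_lattice (hom_poset K A B)"
    and Comp_sup_left:
      "\<lbrakk>X \<in> Obj K; Y \<in> Obj K; Z \<in> Obj K; G \<subseteq> hom K Y Z; f \<in> hom K X Y\<rbrakk>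
       \<Longrightarrow> (\<Squnion>\<^bsub>hom_poset K Y Z\<^esub> G) \<odot> f = \<Squnion>\<^bsub>hom_poset K X Z\<^esub> ((\<lambda>g. g \<odot> f) ` G)"
    and Comp_sup_right:
      "\<lbrakk>X \<in> Obj K; Y \<in> Obj K; Z \<in> Obj K; g \<in> hom K Y Z; F \<subseteq> hom K X Y\<rbrakk>
       \<Longrightarrow> g \<odot> (\<Squnion>\<^bsub>hom_poset K X Y\<^esub> F) = \<Squnion>\<^bsub>hom_poset K X Z\<^esub> ((\<lambda>f. g \<odot> f) ` F)"

text \<open>The equation \<open>[{\<Or>f}\<^sub>j] = \<Or>[{f}\<^sub>j]\<close>: on the left, \<open>f\<close> ranges over \<open>F j\<close> separately in each
  component; on the right, the supremum is over all ways of choosing one \<open>f\<^sub>j \<in> F j\<close> for every \<open>j\<close>.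
  The \<open>F j\<close> have to be nonempty: if one of them is empty there is no such choice, and the
  equation would say that a cotuple with a single bottom component is itself the bottom.
  (In a Sup-enriched category the cotuple of bottoms only is always the bottom.)\<close>

definition cotupling_preserves_sups :: "'s itself \<Rightarrow> ('o, 'a, 'm) ocategory_scheme \<Rightarrow> bool" where
  "cotupling_preserves_sups (_ :: 's itself) K \<longleftrightarrow>
     (\<forall>(I :: 's set) X S \<iota> Y F.
        is_coproduct K I X S \<iota> \<longrightarrow> Y \<in> Obj K \<longrightarrow>
        (\<forall>j\<in>I. F j \<subseteq> hom K (X j) Y \<and> F j \<noteq> {}) \<longrightarrow>
        cotuple K I S \<iota> Y (\<lambda>j. \<Squnion>\<^bsub>hom_poset K (X j) Y\<^esub> (F j)) =
          \<Squnion>\<^bsub>hom_poset K S Y\<^esub> (cotuple K I S \<iota> Y ` (\<Pi>\<^sub>E j\<in>I. F j)))"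

locale ordered_functor = A: ordered_category A + B: ordered_category B + cat_functor A B F
  for A :: "('o, 'a, 'm) ocategory_scheme" and B :: "('p, 'b, 'n) ocategory_scheme"
    and F :: "('o, 'a, 'p, 'b) cat_map" +
  assumes amap_mono: "\<lbrakk>X \<in> Obj A; Y \<in> Obj A\<rbrakk>
    \<Longrightarrow> isotone (hom_poset A X Y) (hom_poset B (omap F X) (omap F Y)) (amap F)"

locale two_adjunction = F: ordered_functor A B F + U: ordered_functor B A U
  for A :: "('o, 'a, 'm) ocategory_scheme" and B :: "('p, 'b, 'n) ocategory_scheme"
    and F :: "('o, 'a, 'p, 'b) cat_map" and U :: "('p, 'b, 'o, 'a) cat_map" +
  fixes \<phi> :: "'o \<Rightarrow> 'p \<Rightarrow> 'b \<Rightarrow> 'a"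
  assumes bij: "\<lbrakk>X \<in> Obj A; Y \<in> Obj B\<rbrakk>
      \<Longrightarrow> bij_betw (\<phi> X Y) (hom B (omap F X) Y) (hom A X (omap U Y))"
    and order_emb: "\<lbrakk>X \<in> Obj A; Y \<in> Obj B\<rbrakk>
      \<Longrightarrow> order_emb (hom_poset B (omap F X) Y) (hom_poset A X (omap U Y)) (\<phi> X Y)"
    and natural: "\<lbrakk>X \<in> Obj A; Y \<in> Obj B; h \<in> hom A X' X; k \<in> hom B Y Y'; g \<in> hom B (omap F X) Y\<rbrakk>
      \<Longrightarrow> \<phi> X' Y' (k \<odot>\<^bsub>B\<^esub> g \<odot>\<^bsub>B\<^esub> amap F h) = amap U k \<odot>\<^bsub>A\<^esub> \<phi> X Y g \<odot>\<^bsub>A\<^esub> h"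

definition has_left_two_adjoint ::
    "('o, 'a, 'm) ocategory_scheme \<Rightarrow> ('p, 'b, 'n) ocategory_scheme \<Rightarrow> ('p, 'b, 'o, 'a) cat_map \<Rightarrow> bool"
  where "has_left_two_adjoint A B U \<longleftrightarrow> (\<exists>F \<phi>. two_adjunction A B F U \<phi>)"


section \<open>Lax functors, oplax transformations and change of base\<close>

locale lax_functor = D: category D + K: ordered_category K
  for D :: "('d, 'e, 'm) category_scheme" and K :: "('o, 'a, 'n) ocategory_scheme" +
  fixes \<pi> :: "('d, 'e, 'o, 'a) cat_map"
  assumes omap_Obj: "X \<in> Obj D \<Longrightarrow> omap \<pi> X \<in> Obj K"
    and amap_hom: "d \<in> hom D X Y \<Longrightarrow> amap \<pi> d \<in> hom K (omap \<pi> X) (omap \<pi> Y)"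
    and lax_Idn: "X \<in> Obj D \<Longrightarrow> Idn K (omap \<pi> X) \<preceq>\<^bsub>K\<^esub> amap \<pi> (Idn D X)"
    and lax_Comp: "\<lbrakk>d\<^sub>2 \<in> hom D X Y; d\<^sub>1 \<in> hom D Y Z\<rbrakk>
                   \<Longrightarrow> amap \<pi> d\<^sub>1 \<odot>\<^bsub>K\<^esub> amap \<pi> d\<^sub>2 \<preceq>\<^bsub>K\<^esub> amap \<pi> (d\<^sub>1 \<odot>\<^bsub>D\<^esub> d\<^sub>2)"

locale oplax_transformation = S: lax_functor D K \<pi> + T: lax_functor D K \<pi>'
  for D :: "('d, 'e, 'm) category_scheme" and K :: "('o, 'a, 'n) ocategory_scheme"
    and \<pi> \<pi>' :: "('d, 'e, 'o, 'a) cat_map" +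
  fixes f :: "'d \<Rightarrow> 'a"
  assumes component: "X \<in> Obj D \<Longrightarrow> f X \<in> hom K (omap \<pi> X) (omap \<pi>' X)"
    and oplax: "d \<in> hom D X Y \<Longrightarrow> f Y \<odot>\<^bsub>K\<^esub> amap \<pi> d \<preceq>\<^bsub>K\<^esub> amap \<pi>' d \<odot>\<^bsub>K\<^esub> f X"

text \<open>The category \<open>[D, K]\<^sup>J\<close>. An arrow carries its source and target along with its components.
  Lax functors and families of components are extensional, i.e. \<open>undefined\<close> outside the
  objects and arrows of \<open>D\<close>, so that HOL equality is equality of lax functors on \<open>D\<close> and of
  transformations.\<close>

record ('d, 'e, 'o, 'a) transf =
  src :: "('d, 'e, 'o, 'a) cat_map"
  tgt :: "('d, 'e, 'o, 'a) cat_map"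
  cmp :: "'d \<Rightarrow> 'a"

definition lax_functors ::
    "('d, 'e, 'm) category_scheme \<Rightarrow> ('o, 'a, 'n) ocategory_scheme \<Rightarrow> ('d, 'e, 'o, 'a) cat_map set" where
  "lax_functors D K =
     {\<pi>. lax_functor D K \<pi> \<and> omap \<pi> \<in> extensional (Obj D) \<and> amap \<pi> \<in> extensional (Arr D)}"

definition lax_functor_category ::
    "('d, 'e, 'm) category_scheme \<Rightarrow> ('o, 'a, 'n) ocategory_scheme \<Rightarrow> ('o, 'a, 'k) category_scheme
     \<Rightarrow> (('d, 'e, 'o, 'a) cat_map, ('d, 'e, 'o, 'a) transf) ocategory" where
  "lax_functor_category D K J =
     \<lparr>Obj = lax_functors D K,
      Arr = {\<tau>. src \<tau> \<in> lax_functors D K \<and> tgt \<tau> \<in> lax_functors D K \<and>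
                oplax_transformation D K (src \<tau>) (tgt \<tau>) (cmp \<tau>) \<and>
                cmp \<tau> \<in> extensional (Obj D) \<and> (\<forall>X\<in>Obj D. cmp \<tau> X \<in> Arr J)},
      Dom = src,
      Cod = tgt,
      Idn = (\<lambda>\<pi>. \<lparr>src = \<pi>, tgt = \<pi>, cmp = (\<lambda>X\<in>Obj D. Idn K (omap \<pi> X))\<rparr>),
      Comp = (\<lambda>\<tau> \<sigma>. \<lparr>src = src \<sigma>, tgt = tgt \<tau>, cmp = (\<lambda>X\<in>Obj D. cmp \<tau> X \<odot>\<^bsub>K\<^esub> cmp \<sigma> X)\<rparr>),
      Leq = (\<lambda>\<sigma> \<tau>. \<forall>X\<in>Obj D. cmp \<sigma> X \<preceq>\<^bsub>K\<^esub> cmp \<tau> X)\<rparr>"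

definition precompose ::
    "('d, 'e, 'm) category_scheme \<Rightarrow> ('d, 'e, 'u, 'v) cat_map
     \<Rightarrow> ('u, 'v, 'o, 'a) cat_map \<Rightarrow> ('d, 'e, 'o, 'a) cat_map" where
  "precompose D p \<pi> =
     \<lparr>omap = (\<lambda>X\<in>Obj D. omap \<pi> (omap p X)), amap = (\<lambda>d\<in>Arr D. amap \<pi> (amap p d))\<rparr>"

text \<open>\<open>[p, K]\<^sup>J\<close>; its formula does not depend on \<open>K\<close> and \<open>J\<close>.\<close>

definition change_of_base ::
    "('d, 'e, 'm) category_scheme \<Rightarrow> ('d, 'e, 'u, 'v) cat_map
     \<Rightarrow> (('u, 'v, 'o, 'a) cat_map, ('u, 'v, 'o, 'a) transf,
         ('d, 'e, 'o, 'a) cat_map, ('d, 'e, 'o, 'a) transf) cat_map" where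
  "change_of_base D p =
     \<lparr>omap = precompose D p,
      amap = (\<lambda>\<tau>. \<lparr>src = precompose D p (src \<tau>), tgt = precompose D p (tgt \<tau>),
                   cmp = (\<lambda>X\<in>Obj D. cmp \<tau> (omap p X))\<rparr>)\<rparr>"

end

theory Submission
  imports Defs
begin

text \<open>The left adjoint sends \<open>\<pi>\<close> to its left Kan extension along \<open>p\<close>, whose value at \<open>e\<close> is the
  coproduct of the \<open>\<pi> X\<close> over the fibre \<open>p X = e\<close>, and whose value at \<open>d : e \<rightarrow> e'\<close> is the cotuple of
  the suprema of \<open>\<iota> Y \<odot> \<pi> c\<close> over all \<open>c : X \<rightarrow> Y\<close> with \<open>p c = d\<close>. Since functors need only be lax,
  it suffices that composition preserves these suprema. Transposition along the unit \<open>\<iota>\<close> is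
  cotupling. All inequalities can be checked after composition with the injections: since cotupling
  preserves binary suprema, hom-sets out of a coproduct are ordered componentwise.\<close>

section \<open>Two-adjunctions from universal arrows\<close>

text \<open>Why fibres and lifts are the right data: for a family \<open>h\<close> with
  \<open>h (omap p X) \<odot> \<iota> X = f X\<close>, oplaxity at \<open>d\<close>, tested on
  \<open>\<iota> X\<close>, compares a supremum with \<open>\<rho> d \<odot> f X\<close>. It says
  that \<open>f Y \<odot> \<pi> c\<close> lies below \<open>\<rho> d \<odot> f X\<close> for every
  lift \<open>c\<close> of \<open>d\<close> starting at \<open>X\<close>, and this is oplaxity of
  \<open>f\<close> at those \<open>c\<close>. So strict fibres suffice and no comma categories
  appear. The price is that the extension is in general only lax, even if \<pi> is strict: a
  composite of lifts lifts the composite, but a lift of a composite need not factor into lifts, and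
  an identity may have lifts other than identities. The subcategory J imposes a second constraint.
  Transposes must have components in J, so they are cotupled in J, while the values of the extension
  on arrows involve suprema and are cotupled in K. Hence one and the same cocone has to be universal
  in both categories.\<close>

lemma homD:
  assumes "f \<in> hom C A B"
  shows "f \<in> Arr C" "Dom C f = A" "Cod C f = B"
  using assms by (auto simp: hom_def)

lemma (in category) hom_Obj:
  assumes "f \<in> hom C A B"
  shows "A \<in> Obj C" "B \<in> Obj C"
  using assms Dom_Obj Cod_Obj by (auto simp: hom_def)

lemma in_carrier_hom_poset [simp]: "f \<in> carrier (hom_poset K A B) \<longleftrightarrow> f \<in> hom K A B"
  and le_hom_poset [simp]: "f \<sqsubseteq>\<^bsub>hom_poset K A B\<^esub> g \<longleftrightarrow> f \<preceq>\<^bsub>K\<^esub> g"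
  by (auto simp: hom_poset_def)

context ordered_category
begin

lemma Leq_refl: "f \<in> hom K A B \<Longrightarrow> f \<preceq> f"
  using hom_partial_order[THEN partial_order.axioms(1), THEN weak_partial_order.le_refl, of A B f]
    hom_Obj[of f A B] by simp

lemma Leq_trans:
  assumes "f \<preceq> g" "g \<preceq> h" "f \<in> hom K A B" "g \<in> hom K A B" "h \<in> hom K A B"
  shows "f \<preceq> h"
  using hom_partial_order[THEN partial_order.axioms(1), THEN weak_partial_order.le_trans, of A B f g h]
    hom_Obj[of f A B] assms by simp

lemma Leq_antisym:
  assumes "f \<preceq> g" "g \<preceq> f" "f \<in> hom K A B" "g \<in> hom K A B"
  shows "f = g"
  using hom_partial_order[THEN partial_order.le_antisym, of A B f g]
    hom_Obj[of f A B] assms by simp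

end

text \<open>Order reflection takes the place of uniqueness of \<open>g\<close>: used in both
  directions, it makes transposition injective by antisymmetry. The converse implication comes from
  monotonicity of \<open>U\<close> and of composition. The functor laws and the monotonicity of
  \<open>F\<close> can then be checked after transposing, where they reduce to naturality of
  \<eta>.\<close>

lemma has_left_two_adjointI:
  fixes A :: "('o, 'a, 'm) ocategory_scheme" and B :: "('p, 'b, 'n) ocategory_scheme"
  assumes U: "ordered_functor B A U"
    and universal: "\<And>X. X \<in> Obj A \<Longrightarrow> \<exists>Y \<eta>. Y \<in> Obj B \<and> \<eta> \<in> hom A X (omap U Y) \<and>
      (\<forall>Z\<in>Obj B. \<forall>f\<in>hom A X (omap U Z). \<exists>g\<in>hom B Y Z. amap U g \<odot>\<^bsub>A\<^esub> \<eta> = f) \<and>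
      (\<forall>Z\<in>Obj B. \<forall>g\<in>hom B Y Z. \<forall>g'\<in>hom B Y Z.
         amap U g \<odot>\<^bsub>A\<^esub> \<eta> \<preceq>\<^bsub>A\<^esub> amap U g' \<odot>\<^bsub>A\<^esub> \<eta> \<longrightarrow> g \<preceq>\<^bsub>B\<^esub> g')"
  shows "has_left_two_adjoint A B U"
proof -
  interpret U: ordered_functor B A U by (rule U)
  define P where "P X Y \<eta> \<longleftrightarrow> Y \<in> Obj B \<and> \<eta> \<in> hom A X (omap U Y) \<and>
      (\<forall>Z\<in>Obj B. \<forall>f\<in>hom A X (omap U Z). \<exists>g\<in>hom B Y Z. amap U g \<odot>\<^bsub>A\<^esub> \<eta> = f) \<and>
      (\<forall>Z\<in>Obj B. \<forall>g\<in>hom B Y Z. \<forall>g'\<in>hom B Y Z.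
         amap U g \<odot>\<^bsub>A\<^esub> \<eta> \<preceq>\<^bsub>A\<^esub> amap U g' \<odot>\<^bsub>A\<^esub> \<eta> \<longrightarrow> g \<preceq>\<^bsub>B\<^esub> g')" for X Y \<eta>
  have "\<forall>X. \<exists>Y \<eta>. X \<in> Obj A \<longrightarrow> P X Y \<eta>" using universal unfolding P_def by blast
  then obtain L \<eta> where P: "\<And>X. X \<in> Obj A \<Longrightarrow> P X (L X) (\<eta> X)" by metis
  have L: "L X \<in> Obj B" and \<eta>: "\<eta> X \<in> hom A X (omap U (L X))" if "X \<in> Obj A" for X
    using P[OF that] by (auto simp: P_def)
  have reflect: "g \<preceq>\<^bsub>B\<^esub> g'" if "X \<in> Obj A" "Z \<in> Obj B" "g \<in> hom B (L X) Z" "g' \<in> hom B (L X) Z"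
    "amap U g \<odot>\<^bsub>A\<^esub> \<eta> X \<preceq>\<^bsub>A\<^esub> amap U g' \<odot>\<^bsub>A\<^esub> \<eta> X" for X Z g g'
    using P[OF that(1)] that(2-) unfolding P_def by blast
  \<comment> \<open>Only existence of an extension is at hand here, hence the choice; uniqueness
    follows later as \<open>\<phi>_inj\<close>.\<close>
  define ext where "ext X Z f = (SOME g. g \<in> hom B (L X) Z \<and> amap U g \<odot>\<^bsub>A\<^esub> \<eta> X = f)" for X Z f
  have ext: "ext X Z f \<in> hom B (L X) Z \<and> amap U (ext X Z f) \<odot>\<^bsub>A\<^esub> \<eta> X = f"
    if "X \<in> Obj A" "Z \<in> Obj B" "f \<in> hom A X (omap U Z)" for X Z f
  proof -
    have "\<exists>g. g \<in> hom B (L X) Z \<and> amap U g \<odot>\<^bsub>A\<^esub> \<eta> X = f"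
      using P[OF that(1)] that(2-) unfolding P_def by blast
    from someI_ex[OF this] show ?thesis by (simp add: ext_def)
  qed
  define \<phi> where "\<phi> X Y g = amap U g \<odot>\<^bsub>A\<^esub> \<eta> X" for X and Y :: 'p and g
  \<comment> \<open>\<open>F\<close> sends \<open>h\<close> to the extension of \<eta> after
    \<open>h\<close>, so that naturality of \<eta>, the fact \<open>F_\<eta>\<close>, holds by
    construction.\<close>
  define F where "F = \<lparr>omap = L,
    amap = (\<lambda>h. ext (Dom A h) (L (Cod A h)) (\<eta> (Cod A h) \<odot>\<^bsub>A\<^esub> h))\<rparr>"
  have \<phi>_hom: "\<phi> X Y g \<in> hom A X (omap U Y)" if "X \<in> Obj A" "g \<in> hom B (L X) Y" for X Y g
    unfolding \<phi>_def using that by (intro U.B.Comp_hom[OF \<eta> U.amap_hom])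
  have \<phi>_iff: "\<phi> X Y g \<preceq>\<^bsub>A\<^esub> \<phi> X Y g' \<longleftrightarrow> g \<preceq>\<^bsub>B\<^esub> g'"
    if X: "X \<in> Obj A" and g: "g \<in> hom B (L X) Y" and g': "g' \<in> hom B (L X) Y" for X Y g g'
  proof
    assume "\<phi> X Y g \<preceq>\<^bsub>A\<^esub> \<phi> X Y g'"
    then show "g \<preceq>\<^bsub>B\<^esub> g'"
      using reflect[OF X _ g g'] U.A.hom_Obj[OF g] by (simp add: \<phi>_def)
  next
    assume le: "g \<preceq>\<^bsub>B\<^esub> g'"
    have "amap U g \<preceq>\<^bsub>A\<^esub> amap U g'"
      using U.amap_mono[of "L X" Y] U.A.hom_Obj[OF g] g g' le by (auto simp: isotone_def)
    then show "\<phi> X Y g \<preceq>\<^bsub>A\<^esub> \<phi> X Y g'"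
      unfolding \<phi>_def
      using U.B.Comp_mono[OF \<eta>[OF X] \<eta>[OF X] U.amap_hom[OF g] U.amap_hom[OF g'] U.B.Leq_refl[OF \<eta>[OF X]]]
      by simp
  qed
  have \<phi>_inj: "g = g'"
    if "X \<in> Obj A" "g \<in> hom B (L X) Y" "g' \<in> hom B (L X) Y" "\<phi> X Y g = \<phi> X Y g'" for X Y g g'
    using that(4) \<phi>_iff[OF that(1-3)] \<phi>_iff[OF that(1,3,2)] U.B.Leq_refl[OF \<phi>_hom[OF that(1,2)]]
      U.A.Leq_antisym[OF _ _ that(2,3)] by simp
  have F_hom: "amap F h \<in> hom B (L X) (L X')"
    and F_\<eta>: "amap U (amap F h) \<odot>\<^bsub>A\<^esub> \<eta> X = \<eta> X' \<odot>\<^bsub>A\<^esub> h" if h: "h \<in> hom A X X'" for X X' h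
  proof -
    have "\<eta> X' \<odot>\<^bsub>A\<^esub> h \<in> hom A X (omap U (L X'))"
      using U.B.Comp_hom[OF h \<eta>[OF U.B.hom_Obj(2)[OF h]]] .
    with ext[of X "L X'"] show "amap F h \<in> hom B (L X) (L X')"
      "amap U (amap F h) \<odot>\<^bsub>A\<^esub> \<eta> X = \<eta> X' \<odot>\<^bsub>A\<^esub> h"
      using L U.B.hom_Obj[OF h] by (auto simp: F_def homD[OF h])
  qed
  have \<phi>_natural: "\<phi> X' Y' (k \<odot>\<^bsub>B\<^esub> g \<odot>\<^bsub>B\<^esub> amap F h) = amap U k \<odot>\<^bsub>A\<^esub> \<phi> X Y g \<odot>\<^bsub>A\<^esub> h"
    if h: "h \<in> hom A X' X" and k: "k \<in> hom B Y Y'" and g: "g \<in> hom B (L X) Y" for X X' Y Y' h k g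
  proof -
    note X = U.B.hom_Obj[OF h]
    note kg = U.A.Comp_hom[OF g k]
    note Ug = U.amap_hom[OF g] and Uk = U.amap_hom[OF k] and UF = U.amap_hom[OF F_hom[OF h]]
    note \<eta>X = \<eta>[OF X(2)] and \<eta>X' = \<eta>[OF X(1)]
    have "\<phi> X' Y' (k \<odot>\<^bsub>B\<^esub> g \<odot>\<^bsub>B\<^esub> amap F h) = (amap U k \<odot>\<^bsub>A\<^esub> amap U g) \<odot>\<^bsub>A\<^esub> (\<eta> X \<odot>\<^bsub>A\<^esub> h)"
      unfolding \<phi>_def U.amap_Comp[OF F_hom[OF h] kg] U.amap_Comp[OF g k]
      using U.B.Comp_assoc[OF \<eta>X' UF U.B.Comp_hom[OF Ug Uk]] F_\<eta>[OF h] by simp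
    also have "\<dots> = (amap U k \<odot>\<^bsub>A\<^esub> amap U g) \<odot>\<^bsub>A\<^esub> \<eta> X \<odot>\<^bsub>A\<^esub> h"
      using U.B.Comp_assoc[OF h \<eta>X U.B.Comp_hom[OF Ug Uk]] by simp
    also have "\<dots> = amap U k \<odot>\<^bsub>A\<^esub> \<phi> X Y g \<odot>\<^bsub>A\<^esub> h"
      unfolding \<phi>_def using U.B.Comp_assoc[OF \<eta>X Ug Uk] by simp
    finally show ?thesis .
  qed
  have "two_adjunction A B F U \<phi>"
  proof
    fix X assume X: "X \<in> Obj A"
    show "omap F X \<in> Obj B" using L[OF X] by (simp add: F_def)
    note I = U.B.Idn_hom[OF X] and IL = U.A.Idn_hom[OF L[OF X]]
    \<comment> \<open>As with composition below, the two candidates have the same transpose, so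
      \<open>\<phi>_inj\<close> identifies them.\<close>
    have "\<phi> X (L X) (amap F (Idn A X)) = \<phi> X (L X) (Idn B (L X))"
      unfolding \<phi>_def F_\<eta>[OF I] U.amap_Idn[OF L[OF X]]
      using U.B.Comp_Idn[OF \<eta>[OF X]] U.B.Idn_Comp[OF \<eta>[OF X]] by simp
    then show "amap F (Idn A X) = Idn B (omap F X)"
      using \<phi>_inj[OF X F_hom[OF I] IL] by (simp add: F_def)
  next
    fix f X Y assume "f \<in> hom A X Y"
    then show "amap F f \<in> hom B (omap F X) (omap F Y)" using F_hom by (simp add: F_def)
  next
    fix f g X Y Z assume f: "f \<in> hom A X Y" and g: "g \<in> hom A Y Z"
    note X = U.B.hom_Obj(1)[OF f] and Y = U.B.hom_Obj[OF g] and gf = U.B.Comp_hom[OF f g]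
    have "\<phi> X (L Z) (amap F (g \<odot>\<^bsub>A\<^esub> f)) = (\<eta> Z \<odot>\<^bsub>A\<^esub> g) \<odot>\<^bsub>A\<^esub> f"
      unfolding \<phi>_def F_\<eta>[OF gf] using U.B.Comp_assoc[OF f g \<eta>[OF Y(2)]] by simp
    also have "\<dots> = amap U (amap F g) \<odot>\<^bsub>A\<^esub> (\<eta> Y \<odot>\<^bsub>A\<^esub> f)"
      using U.B.Comp_assoc[OF f \<eta>[OF Y(1)] U.amap_hom[OF F_hom[OF g]]] F_\<eta>[OF g] by simp
    also have "\<dots> = \<phi> X (L Z) (amap F g \<odot>\<^bsub>B\<^esub> amap F f)"
      unfolding \<phi>_def U.amap_Comp[OF F_hom[OF f] F_hom[OF g]]
      using U.B.Comp_assoc[OF \<eta>[OF X] U.amap_hom[OF F_hom[OF f]] U.amap_hom[OF F_hom[OF g]]] F_\<eta>[OF f]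
      by simp
    finally show "amap F (g \<odot>\<^bsub>A\<^esub> f) = amap F g \<odot>\<^bsub>B\<^esub> amap F f"
      using \<phi>_inj[OF X F_hom[OF gf] U.A.Comp_hom[OF F_hom[OF f] F_hom[OF g]]] by simp
  next
    fix X X' assume X: "X \<in> Obj A" "X' \<in> Obj A"
    have "amap F f \<preceq>\<^bsub>B\<^esub> amap F g" if f: "f \<in> hom A X X'" and g: "g \<in> hom A X X'" and "f \<preceq>\<^bsub>A\<^esub> g" for f g
    proof -
      have "\<phi> X (L X') (amap F f) \<preceq>\<^bsub>A\<^esub> \<phi> X (L X') (amap F g)"
        unfolding \<phi>_def F_\<eta>[OF f] F_\<eta>[OF g]
        using U.B.Comp_mono[OF f g \<eta>[OF X(2)] \<eta>[OF X(2)] that(3) U.B.Leq_refl[OF \<eta>[OF X(2)]]] .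
      then show ?thesis using \<phi>_iff[OF X(1) F_hom[OF f] F_hom[OF g]] by simp
    qed
    then show "isotone (hom_poset A X X') (hom_poset B (omap F X) (omap F X')) (amap F)"
      using U.B.hom_partial_order[OF X] U.A.hom_partial_order[OF L[OF X(1)] L[OF X(2)]]
      by (auto simp: isotone_def F_def partial_order_def)
  next
    fix X Y assume X: "X \<in> Obj A" and Y: "Y \<in> Obj B"
    show "bij_betw (\<phi> X Y) (hom B (omap F X) Y) (hom A X (omap U Y))"
    proof (rule bij_betwI')
      show "\<exists>g\<in>hom B (omap F X) Y. f = \<phi> X Y g" if "f \<in> hom A X (omap U Y)" for f
        using ext[OF X Y that] by (intro bexI[of _ "ext X Y f"]) (simp_all add: \<phi>_def F_def)
      show "\<phi> X Y g \<in> hom A X (omap U Y)" if "g \<in> hom B (omap F X) Y" for g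
        using \<phi>_hom[OF X] that by (simp add: F_def)
      show "\<phi> X Y g = \<phi> X Y g' \<longleftrightarrow> g = g'" if "g \<in> hom B (omap F X) Y" "g' \<in> hom B (omap F X) Y" for g g'
        using \<phi>_inj[OF X] that by (auto simp: F_def)
    qed
    show "order_emb (hom_poset B (omap F X) Y) (hom_poset A X (omap U Y)) (\<phi> X Y)"
      using U.A.hom_partial_order[OF L[OF X] Y] U.B.hom_partial_order[OF X U.omap_Obj[OF Y]] \<phi>_iff X
      by (auto simp: order_emb_def F_def partial_order_def)
  next
    fix X Y h k g X' Y'
    assume "h \<in> hom A X' X" "k \<in> hom B Y Y'" "g \<in> hom B (omap F X) Y"
    then show "\<phi> X' Y' (k \<odot>\<^bsub>B\<^esub> g \<odot>\<^bsub>B\<^esub> amap F h) = amap U k \<odot>\<^bsub>A\<^esub> \<phi> X Y g \<odot>\<^bsub>A\<^esub> h"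
      using \<phi>_natural by (simp add: F_def)
  qed
  then show ?thesis by (auto simp: has_left_two_adjoint_def)
qed

section \<open>Coproducts with componentwise ordered hom-sets\<close>

text \<open>A single cocone serves J and K: cotuples of families in J stay in J, yet can be compared
  with arrows of K through the same injections. The last clause says that the injections are jointly
  order-epic; its converse is monotonicity of composition.\<close>

definition ordered_coproduct ::
    "('o, 'a, 'm) category_scheme \<Rightarrow> ('o, 'a, 'n) ocategory_scheme \<Rightarrow>
     'i set \<Rightarrow> ('i \<Rightarrow> 'o) \<Rightarrow> 'o \<Rightarrow> ('i \<Rightarrow> 'a) \<Rightarrow> bool" where
  "ordered_coproduct J K I X S \<iota> \<longleftrightarrow>
     is_coproduct J I X S \<iota> \<and> is_coproduct K I X S \<iota> \<and>
     (\<forall>Y\<in>Obj K. \<forall>f\<in>hom K S Y. \<forall>g\<in>hom K S Y.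
        (\<forall>i\<in>I. f \<odot>\<^bsub>K\<^esub> \<iota> i \<preceq>\<^bsub>K\<^esub> g \<odot>\<^bsub>K\<^esub> \<iota> i) \<longrightarrow> f \<preceq>\<^bsub>K\<^esub> g)"

lemma coproduct_ex1:
  assumes S: "is_coproduct C I X S \<iota>" and Y: "Y \<in> Obj C"
    and f: "\<And>i. i \<in> I \<Longrightarrow> f i \<in> hom C (X i) Y"
  shows "\<exists>!h. h \<in> hom C S Y \<and> (\<forall>i\<in>I. h \<odot>\<^bsub>C\<^esub> \<iota> i = f i)"
proof -
  from S have "\<forall>Y\<in>Obj C. \<forall>f. (\<forall>i\<in>I. f i \<in> hom C (X i) Y) \<longrightarrow>
        (\<exists>!h. h \<in> hom C S Y \<and> (\<forall>i\<in>I. h \<odot>\<^bsub>C\<^esub> \<iota> i = f i))"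
    by (simp add: is_coproduct_def)
  from this[rule_format, of Y f, OF Y f] show ?thesis .
qed

lemma ordered_coproductD:
  assumes "ordered_coproduct J K I X S \<iota>"
  shows "S \<in> Obj K"
    and "i \<in> I \<Longrightarrow> \<iota> i \<in> hom J (X i) S"
    and "i \<in> I \<Longrightarrow> \<iota> i \<in> hom K (X i) S"
    and "\<lbrakk>Y \<in> Obj K; \<And>i. i \<in> I \<Longrightarrow> u i \<in> hom K (X i) Y\<rbrakk>
         \<Longrightarrow> \<exists>h\<in>hom K S Y. \<forall>i\<in>I. h \<odot>\<^bsub>K\<^esub> \<iota> i = u i"
    and "\<lbrakk>Y \<in> Obj J; \<And>i. i \<in> I \<Longrightarrow> u i \<in> hom J (X i) Y\<rbrakk>
         \<Longrightarrow> \<exists>h\<in>hom J S Y. \<forall>i\<in>I. h \<odot>\<^bsub>J\<^esub> \<iota> i = u i"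
    and "\<lbrakk>f \<in> hom K S Y; g \<in> hom K S Y; Y \<in> Obj K;
          \<And>i. i \<in> I \<Longrightarrow> f \<odot>\<^bsub>K\<^esub> \<iota> i \<preceq>\<^bsub>K\<^esub> g \<odot>\<^bsub>K\<^esub> \<iota> i\<rbrakk> \<Longrightarrow> f \<preceq>\<^bsub>K\<^esub> g"
proof -
  have J: "is_coproduct J I X S \<iota>" and K: "is_coproduct K I X S \<iota>"
    using assms by (auto simp: ordered_coproduct_def)
  show "S \<in> Obj K" "i \<in> I \<Longrightarrow> \<iota> i \<in> hom J (X i) S" "i \<in> I \<Longrightarrow> \<iota> i \<in> hom K (X i) S"
    using J K by (auto simp: is_coproduct_def)
  show "\<lbrakk>Y \<in> Obj K; \<And>i. i \<in> I \<Longrightarrow> u i \<in> hom K (X i) Y\<rbrakk>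
      \<Longrightarrow> \<exists>h\<in>hom K S Y. \<forall>i\<in>I. h \<odot>\<^bsub>K\<^esub> \<iota> i = u i"
    using coproduct_ex1[OF K, of Y u] by blast
  show "\<lbrakk>Y \<in> Obj J; \<And>i. i \<in> I \<Longrightarrow> u i \<in> hom J (X i) Y\<rbrakk>
      \<Longrightarrow> \<exists>h\<in>hom J S Y. \<forall>i\<in>I. h \<odot>\<^bsub>J\<^esub> \<iota> i = u i"
    using coproduct_ex1[OF J, of Y u] by blast
  show "\<lbrakk>f \<in> hom K S Y; g \<in> hom K S Y; Y \<in> Obj K;
      \<And>i. i \<in> I \<Longrightarrow> f \<odot>\<^bsub>K\<^esub> \<iota> i \<preceq>\<^bsub>K\<^esub> g \<odot>\<^bsub>K\<^esub> \<iota> i\<rbrakk> \<Longrightarrow> f \<preceq>\<^bsub>K\<^esub> g"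
    using assms unfolding ordered_coproduct_def by blast
qed

text \<open>The hypotheses on small coproducts concern index sets of type \<open>'s set\<close>,
  whereas the fibres of \<open>p\<close> consist of objects of the source category; this lemma
  bridges the two.\<close>

lemma is_coproduct_reindex:
  assumes "bij_betw b I I'" and S: "is_coproduct C I' X S \<iota>"
  shows "is_coproduct C I (X \<circ> b) S (\<iota> \<circ> b)"
proof -
  define c where "c = inv_into I b"
  have b: "b i \<in> I'" "c (b i) = i" if "i \<in> I" for i
    using assms(1) that by (auto simp: c_def bij_betw_def)
  have c: "c j \<in> I" "b (c j) = j" if "j \<in> I'" for j
    using assms(1) that by (auto simp: c_def bij_betw_def inv_into_into f_inv_into_f)
  have "\<exists>!h. h \<in> hom C S Y \<and> (\<forall>i\<in>I. h \<odot>\<^bsub>C\<^esub> \<iota> (b i) = f i)"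
    if Y: "Y \<in> Obj C" and f: "\<And>i. i \<in> I \<Longrightarrow> f i \<in> hom C (X (b i)) Y" for Y f
  proof -
    have "f (c j) \<in> hom C (X j) Y" if "j \<in> I'" for j using f[of "c j"] c[OF that] by simp
    then have "\<exists>!h. h \<in> hom C S Y \<and> (\<forall>j\<in>I'. h \<odot>\<^bsub>C\<^esub> \<iota> j = f (c j))"
      using coproduct_ex1[OF S Y, of "\<lambda>j. f (c j)"] by blast
    moreover have "(\<forall>j\<in>I'. h \<odot>\<^bsub>C\<^esub> \<iota> j = f (c j)) \<longleftrightarrow> (\<forall>i\<in>I. h \<odot>\<^bsub>C\<^esub> \<iota> (b i) = f i)" for h
      using b c by metis
    ultimately show ?thesis by simp
  qed
  with S b show ?thesis by (auto simp: is_coproduct_def)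
qed

section \<open>Suprema in hom-sets and the order on arrows out of a coproduct\<close>

context sup_enriched_category
begin

lemma sup_hom:
  assumes "G \<subseteq> hom K X Y" "X \<in> Obj K" "Y \<in> Obj K"
  shows "\<Squnion>\<^bsub>hom_poset K X Y\<^esub> G \<in> hom K X Y"
proof -
  interpret L: complete_lattice "hom_poset K X Y" using assms hom_complete_lattice by blast
  show ?thesis using L.sup_closed[of G] assms by (auto simp: subset_iff)
qed

lemma sup_upper:
  assumes "G \<subseteq> hom K X Y" "X \<in> Obj K" "Y \<in> Obj K" "g \<in> G"
  shows "g \<preceq> \<Squnion>\<^bsub>hom_poset K X Y\<^esub> G"
proof -
  interpret L: complete_lattice "hom_poset K X Y" using assms hom_complete_lattice by blast
  show ?thesis using L.sup_upper[of G g] assms by (auto simp: subset_iff)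
qed

lemma sup_least:
  assumes "G \<subseteq> hom K X Y" "h \<in> hom K X Y" "\<And>g. g \<in> G \<Longrightarrow> g \<preceq> h"
  shows "\<Squnion>\<^bsub>hom_poset K X Y\<^esub> G \<preceq> h"
proof -
  interpret L: complete_lattice "hom_poset K X Y" using hom_Obj[OF assms(2)] hom_complete_lattice by blast
  show ?thesis using L.sup_least[of G h] assms by (auto simp: subset_iff)
qed

lemma cotupling_reflects_order:
  fixes I :: "'s set"
  assumes cotup: "cotupling_preserves_sups TYPE('s) K" and S: "is_coproduct K I X S \<iota>"
    and f: "f \<in> hom K S Y" and g: "g \<in> hom K S Y"
    and le: "\<And>i. i \<in> I \<Longrightarrow> f \<odot> \<iota> i \<preceq> g \<odot> \<iota> i"
  shows "f \<preceq> g"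
proof -
  have Y: "S \<in> Obj K" "Y \<in> Obj K" using hom_Obj f by auto
  have \<iota>: "\<iota> i \<in> hom K (X i) S" if "i \<in> I" for i
    using S that by (auto simp: is_coproduct_def)
  \<comment> \<open>Cotupling preserves the suprema \<open>g \<odot> \<iota> i\<close> of these sets, and \<open>f\<close> is one of the cotuples of choices.\<close>
  define F where "F i = {f \<odot> \<iota> i, g \<odot> \<iota> i}" for i
  have F: "F i \<subseteq> hom K (X i) Y" if "i \<in> I" for i
    using Comp_hom[OF \<iota>[OF that]] f g by (auto simp: F_def)
  have ex: "\<exists>!h. h \<in> hom K S Y \<and> (\<forall>i\<in>I. h \<odot> \<iota> i = u i)"
    if "\<And>i. i \<in> I \<Longrightarrow> u i \<in> hom K (X i) Y" for u
    by (rule coproduct_ex1[OF S Y(2)]) (rule that)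
  have cotuple_eq: "cotuple K I S \<iota> Y u = h"
    if h: "h \<in> hom K S Y" and u: "\<And>i. i \<in> I \<Longrightarrow> h \<odot> \<iota> i = u i" for u h
  proof -
    have "u i \<in> hom K (X i) Y" if "i \<in> I" for i
      using Comp_hom[OF \<iota>[OF that] h] u[OF that] by simp
    then show ?thesis
      unfolding cotuple_def using h u ex[of u] by (intro the1_equality) auto
  qed
  have sup_F: "\<Squnion>\<^bsub>hom_poset K (X i) Y\<^esub> (F i) = g \<odot> \<iota> i" if i: "i \<in> I" for i
  proof (rule Leq_antisym)
    show g\<iota>: "g \<odot> \<iota> i \<in> hom K (X i) Y" using Comp_hom[OF \<iota>[OF i] g] .
    show "\<Squnion>\<^bsub>hom_poset K (X i) Y\<^esub> (F i) \<preceq> g \<odot> \<iota> i"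
      using sup_least[OF F[OF i] g\<iota>] le[OF i] Leq_refl[OF g\<iota>] by (auto simp: F_def)
    show "g \<odot> \<iota> i \<preceq> \<Squnion>\<^bsub>hom_poset K (X i) Y\<^esub> (F i)"
      using sup_upper[OF F[OF i]] hom_Obj[OF g\<iota>] by (auto simp: F_def)
    show "\<Squnion>\<^bsub>hom_poset K (X i) Y\<^esub> (F i) \<in> hom K (X i) Y"
      using sup_hom[OF F[OF i]] hom_Obj[OF g\<iota>] by auto
  qed
  have "\<forall>i\<in>I. F i \<subseteq> hom K (X i) Y \<and> F i \<noteq> {}" using F by (auto simp: F_def)
  with cotup S Y(2) have "cotuple K I S \<iota> Y (\<lambda>i. \<Squnion>\<^bsub>hom_poset K (X i) Y\<^esub> (F i)) =
      \<Squnion>\<^bsub>hom_poset K S Y\<^esub> (cotuple K I S \<iota> Y ` (\<Pi>\<^sub>E i\<in>I. F i))"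
    unfolding cotupling_preserves_sups_def by blast
  moreover have "cotuple K I S \<iota> Y (\<lambda>i. \<Squnion>\<^bsub>hom_poset K (X i) Y\<^esub> (F i)) = g"
    by (rule cotuple_eq[OF g]) (simp add: sup_F)
  ultimately have g_eq: "g = \<Squnion>\<^bsub>hom_poset K S Y\<^esub> (cotuple K I S \<iota> Y ` (\<Pi>\<^sub>E i\<in>I. F i))" by simp
  \<comment> \<open>The supremum also ranges over choices that mix components of \<open>f\<close>
    and \<open>g\<close>. Nothing has to be known about their cotuples beyond membership in the
    hom-set, since only the upper bound property at \<open>f\<close> is used.\<close>
  have "cotuple K I S \<iota> Y u \<in> hom K S Y" if "u \<in> (\<Pi>\<^sub>E i\<in>I. F i)" for u
  proof -
    have "u i \<in> hom K (X i) Y" if "i \<in> I" for i using F[OF that] PiE_mem[OF \<open>u \<in> _\<close> that] by blast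
    with theI'[OF ex[of u]] show ?thesis unfolding cotuple_def by blast
  qed
  moreover have "f \<in> cotuple K I S \<iota> Y ` (\<Pi>\<^sub>E i\<in>I. F i)"
  proof
    show "f = cotuple K I S \<iota> Y (\<lambda>i\<in>I. f \<odot> \<iota> i)" by (rule cotuple_eq[symmetric, OF f]) simp
    show "(\<lambda>i\<in>I. f \<odot> \<iota> i) \<in> (\<Pi>\<^sub>E i\<in>I. F i)" by (auto simp: F_def)
  qed
  ultimately show ?thesis
    using sup_upper[of "cotuple K I S \<iota> Y ` (\<Pi>\<^sub>E i\<in>I. F i)" S Y f] Y g_eq by auto
qed

end

text \<open>The coproduct is formed in J and carried to K by the inclusion. Coproducts chosen
  separately would be isomorphic in K, but by an isomorphism that might lie outside J.\<close>

lemma ordered_coproduct_exists: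
  assumes small: "small TYPE('s) I"
    and J: "has_small_coproducts TYPE('s) J"
    and pres: "inclusion_preserves_small_coproducts TYPE('s) J K"
    and K: "sup_enriched_category K" and cotup: "cotupling_preserves_sups TYPE('s) K"
    and X: "\<And>i. i \<in> I \<Longrightarrow> X i \<in> Obj J"
  shows "\<exists>S \<iota>. ordered_coproduct J K I X S \<iota>"
proof -
  from small obtain b :: "_ \<Rightarrow> 's" where "inj_on b I" by (auto simp: small_def)
  then have b: "bij_betw b I (b ` I)" by (simp add: bij_betw_def)
  define X' where "X' = X \<circ> inv_into I b"
  have X_eq: "(X' \<circ> b) i = X i" if "i \<in> I" for i
    using \<open>inj_on b I\<close> that by (simp add: X'_def)
  have "\<forall>j\<in>b ` I. X' j \<in> Obj J" using X X_eq by auto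
  with J obtain S \<iota> where S: "is_coproduct J (b ` I) X' S \<iota>"
    unfolding has_small_coproducts_def by blast
  with pres have S': "is_coproduct K (b ` I) X' S \<iota>"
    unfolding inclusion_preserves_small_coproducts_def by blast
  have "f \<preceq>\<^bsub>K\<^esub> g" if "f \<in> hom K S Y" "g \<in> hom K S Y"
    "\<forall>i\<in>I. f \<odot>\<^bsub>K\<^esub> (\<iota> \<circ> b) i \<preceq>\<^bsub>K\<^esub> g \<odot>\<^bsub>K\<^esub> (\<iota> \<circ> b) i" for f g Y
    using sup_enriched_category.cotupling_reflects_order[OF K cotup S'] that by auto
  moreover have "is_coproduct J I X S (\<iota> \<circ> b)" "is_coproduct K I X S (\<iota> \<circ> b)"
    using is_coproduct_reindex[OF b S] is_coproduct_reindex[OF b S'] X_eq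
    by (simp_all add: is_coproduct_def)
  ultimately have "ordered_coproduct J K I X S (\<iota> \<circ> b)"
    unfolding ordered_coproduct_def by blast
  then show ?thesis by blast
qed

section \<open>Lax functor categories\<close>

lemma lax_functor_category_simps [simp]:
  "Obj (lax_functor_category D K J) = lax_functors D K"
  "Dom (lax_functor_category D K J) = src"
  "Cod (lax_functor_category D K J) = tgt"
  "Idn (lax_functor_category D K J) \<pi> = \<lparr>src = \<pi>, tgt = \<pi>, cmp = (\<lambda>X\<in>Obj D. Idn K (omap \<pi> X))\<rparr>"
  "\<tau> \<odot>\<^bsub>lax_functor_category D K J\<^esub> \<sigma> =
     \<lparr>src = src \<sigma>, tgt = tgt \<tau>, cmp = (\<lambda>X\<in>Obj D. cmp \<tau> X \<odot>\<^bsub>K\<^esub> cmp \<sigma> X)\<rparr>"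
  "\<sigma> \<preceq>\<^bsub>lax_functor_category D K J\<^esub> \<tau> \<longleftrightarrow> (\<forall>X\<in>Obj D. cmp \<sigma> X \<preceq>\<^bsub>K\<^esub> cmp \<tau> X)"
  by (simp_all add: lax_functor_category_def)

lemma lax_functorsD:
  assumes "\<pi> \<in> lax_functors D K"
  shows "lax_functor D K \<pi>" "omap \<pi> \<in> extensional (Obj D)" "amap \<pi> \<in> extensional (Arr D)"
  using assms by (auto simp: lax_functors_def)

locale ordered_wide_subcategory = subcategory J K + K: ordered_category K
  for J :: "('o, 'a, 'm) category_scheme" and K :: "('o, 'a, 'n) ocategory_scheme" +
  assumes Obj_eq: "Obj J = Obj K"
begin

lemma hom_sub: "f \<in> hom J X Y \<Longrightarrow> f \<in> hom K X Y"
  using Arr_sub Dom_eq Cod_eq by (auto simp: hom_def)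

lemma hom_J_iff: "f \<in> hom J X Y \<longleftrightarrow> f \<in> hom K X Y \<and> f \<in> Arr J"
  using Arr_sub Dom_eq Cod_eq by (auto simp: hom_def)

lemma transf_homI:
  assumes \<pi>: "\<pi> \<in> lax_functors D K" "\<pi>' \<in> lax_functors D K"
    and f: "\<And>X. X \<in> Obj D \<Longrightarrow> f X \<in> hom J (omap \<pi> X) (omap \<pi>' X)"
    and oplax: "\<And>d X Y. d \<in> hom D X Y \<Longrightarrow> f Y \<odot>\<^bsub>K\<^esub> amap \<pi> d \<preceq>\<^bsub>K\<^esub> amap \<pi>' d \<odot>\<^bsub>K\<^esub> f X"
  shows "\<lparr>src = \<pi>, tgt = \<pi>', cmp = (\<lambda>X\<in>Obj D. f X)\<rparr> \<in> hom (lax_functor_category D K J) \<pi> \<pi>'"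
proof -
  interpret S: lax_functor D K \<pi> using lax_functorsD(1)[OF \<pi>(1)] .
  interpret T: lax_functor D K \<pi>' using lax_functorsD(1)[OF \<pi>(2)] .
  have "oplax_transformation D K \<pi> \<pi>' (\<lambda>X\<in>Obj D. f X)"
  proof
    show "(\<lambda>X\<in>Obj D. f X) X \<in> hom K (omap \<pi> X) (omap \<pi>' X)" if "X \<in> Obj D" for X
      using hom_sub[OF f[OF that]] that by simp
    show "(\<lambda>X\<in>Obj D. f X) Y \<odot>\<^bsub>K\<^esub> amap \<pi> d \<preceq>\<^bsub>K\<^esub> amap \<pi>' d \<odot>\<^bsub>K\<^esub> (\<lambda>X\<in>Obj D. f X) X"
      if "d \<in> hom D X Y" for d X Y
      using oplax[OF that] S.D.hom_Obj[OF that] by simp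
  qed
  with \<pi> homD(1)[OF f] show ?thesis
    by (simp add: hom_def lax_functor_category_def)
qed

lemma transf_homD:
  assumes "\<tau> \<in> hom (lax_functor_category D K J) \<pi> \<pi>'"
  shows "src \<tau> = \<pi>" "tgt \<tau> = \<pi>'" "\<pi> \<in> lax_functors D K" "\<pi>' \<in> lax_functors D K"
    and "cmp \<tau> \<in> extensional (Obj D)"
    and "X \<in> Obj D \<Longrightarrow> cmp \<tau> X \<in> hom J (omap \<pi> X) (omap \<pi>' X)"
    and "X \<in> Obj D \<Longrightarrow> cmp \<tau> X \<in> hom K (omap \<pi> X) (omap \<pi>' X)"
    and "d \<in> hom D X Y \<Longrightarrow> cmp \<tau> Y \<odot>\<^bsub>K\<^esub> amap \<pi> d \<preceq>\<^bsub>K\<^esub> amap \<pi>' d \<odot>\<^bsub>K\<^esub> cmp \<tau> X"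
proof -
  show \<pi>: "src \<tau> = \<pi>" "tgt \<tau> = \<pi>'" using homD(2,3)[OF assms] by simp_all
  have "oplax_transformation D K \<pi> \<pi>' (cmp \<tau>)" and J: "\<And>X. X \<in> Obj D \<Longrightarrow> cmp \<tau> X \<in> Arr J"
    and "\<pi> \<in> lax_functors D K" "\<pi>' \<in> lax_functors D K" "cmp \<tau> \<in> extensional (Obj D)"
    using homD(1)[OF assms] \<pi> by (simp_all add: lax_functor_category_def)
  then interpret oplax_transformation D K \<pi> \<pi>' "cmp \<tau>" by simp
  show "\<pi> \<in> lax_functors D K" "\<pi>' \<in> lax_functors D K" "cmp \<tau> \<in> extensional (Obj D)" by fact+
  show "X \<in> Obj D \<Longrightarrow> cmp \<tau> X \<in> hom K (omap \<pi> X) (omap \<pi>' X)" by (rule component)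
  then show "X \<in> Obj D \<Longrightarrow> cmp \<tau> X \<in> hom J (omap \<pi> X) (omap \<pi>' X)" using J by (simp add: hom_J_iff)
  show "d \<in> hom D X Y \<Longrightarrow> cmp \<tau> Y \<odot>\<^bsub>K\<^esub> amap \<pi> d \<preceq>\<^bsub>K\<^esub> amap \<pi>' d \<odot>\<^bsub>K\<^esub> cmp \<tau> X" by (rule oplax)
qed

lemma transf_eqI:
  assumes "\<sigma> \<in> hom (lax_functor_category D K J) \<pi> \<pi>'" "\<tau> \<in> hom (lax_functor_category D K J) \<pi> \<pi>'"
    and "\<And>X. X \<in> Obj D \<Longrightarrow> cmp \<sigma> X = cmp \<tau> X"
  shows "\<sigma> = \<tau>"
proof (rule transf.equality)
  show "cmp \<sigma> = cmp \<tau>"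
    using transf_homD(5)[OF assms(1)] transf_homD(5)[OF assms(2)] assms(3) by (rule extensionalityI)
qed (use transf_homD(1,2)[OF assms(1)] transf_homD(1,2)[OF assms(2)] in simp_all)

lemma ordered_category_lax_functor_category:
  assumes "category D"
  shows "ordered_category (lax_functor_category D K J)" (is "ordered_category ?L")
proof -
  interpret D: category D by fact
  have Idn: "Idn ?L \<pi> \<in> hom ?L \<pi> \<pi>" if \<pi>: "\<pi> \<in> lax_functors D K" for \<pi>
  proof -
    interpret \<pi>: lax_functor D K \<pi> using lax_functorsD(1)[OF \<pi>] .
    show ?thesis unfolding lax_functor_category_simps
    proof (rule transf_homI[OF \<pi> \<pi>])
      \<comment> \<open>Here it matters that J contains every object of K: the identity components
        then belong to J.\<close>
      show "Idn K (omap \<pi> X) \<in> hom J (omap \<pi> X) (omap \<pi> X)" if "X \<in> Obj D" for X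
        using \<pi>.omap_Obj[OF that] J.Idn_hom Obj_eq Idn_eq by metis
      show "Idn K (omap \<pi> Y) \<odot>\<^bsub>K\<^esub> amap \<pi> d \<preceq>\<^bsub>K\<^esub> amap \<pi> d \<odot>\<^bsub>K\<^esub> Idn K (omap \<pi> X)"
        if "d \<in> hom D X Y" for d X Y
        using K.Idn_Comp[OF \<pi>.amap_hom[OF that]] K.Comp_Idn[OF \<pi>.amap_hom[OF that]]
          K.Leq_refl[OF \<pi>.amap_hom[OF that]] by simp
    qed
  qed
  have Comp: "\<tau> \<odot>\<^bsub>?L\<^esub> \<sigma> \<in> hom ?L \<pi> \<pi>''"
    if \<sigma>: "\<sigma> \<in> hom ?L \<pi> \<pi>'" and \<tau>: "\<tau> \<in> hom ?L \<pi>' \<pi>''" for \<sigma> \<tau> \<pi> \<pi>' \<pi>''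
  proof -
    note S = transf_homD[OF \<sigma>] and T = transf_homD[OF \<tau>]
    interpret \<pi>: lax_functor D K \<pi> using lax_functorsD(1)[OF S(3)] .
    interpret \<pi>': lax_functor D K \<pi>' using lax_functorsD(1)[OF T(3)] .
    interpret \<pi>'': lax_functor D K \<pi>'' using lax_functorsD(1)[OF T(4)] .
    show ?thesis unfolding lax_functor_category_simps S(1) T(2)
    proof (rule transf_homI[OF S(3) T(4)])
      show "cmp \<tau> X \<odot>\<^bsub>K\<^esub> cmp \<sigma> X \<in> hom J (omap \<pi> X) (omap \<pi>'' X)" if "X \<in> Obj D" for X
        using J.Comp_hom[OF S(6)[OF that] T(6)[OF that]] Comp_eq[OF S(6)[OF that] T(6)[OF that]] by simp
      show "cmp \<tau> Y \<odot>\<^bsub>K\<^esub> cmp \<sigma> Y \<odot>\<^bsub>K\<^esub> amap \<pi> d \<preceq>\<^bsub>K\<^esub> amap \<pi>'' d \<odot>\<^bsub>K\<^esub> (cmp \<tau> X \<odot>\<^bsub>K\<^esub> cmp \<sigma> X)"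
        if d: "d \<in> hom D X Y" for d X Y
      proof -
        note X = D.hom_Obj(1)[OF d] and Y = D.hom_Obj(2)[OF d]
        note d0 = \<pi>.amap_hom[OF d] and d1 = \<pi>'.amap_hom[OF d] and d2 = \<pi>''.amap_hom[OF d]
        note s = S(7)[OF X] S(7)[OF Y] and t = T(7)[OF X] T(7)[OF Y]
        \<comment> \<open>The oplax squares of \<sigma> and \<tau> are pasted; the middle term
          \<open>cmp \<tau> Y \<odot> amap \<pi>' d \<odot> cmp \<sigma> X\<close> occurs in both
          bracketings.\<close>
        have "cmp \<tau> Y \<odot>\<^bsub>K\<^esub> (cmp \<sigma> Y \<odot>\<^bsub>K\<^esub> amap \<pi> d) \<preceq>\<^bsub>K\<^esub> cmp \<tau> Y \<odot>\<^bsub>K\<^esub> (amap \<pi>' d \<odot>\<^bsub>K\<^esub> cmp \<sigma> X)"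
          using K.Comp_mono[OF K.Comp_hom[OF d0 s(2)] K.Comp_hom[OF s(1) d1] t(2) t(2)
            S(8)[OF d] K.Leq_refl[OF t(2)]] .
        moreover have "(cmp \<tau> Y \<odot>\<^bsub>K\<^esub> amap \<pi>' d) \<odot>\<^bsub>K\<^esub> cmp \<sigma> X \<preceq>\<^bsub>K\<^esub> (amap \<pi>'' d \<odot>\<^bsub>K\<^esub> cmp \<tau> X) \<odot>\<^bsub>K\<^esub> cmp \<sigma> X"
          using K.Comp_mono[OF s(1) s(1) K.Comp_hom[OF d1 t(2)] K.Comp_hom[OF t(1) d2]
            K.Leq_refl[OF s(1)] T(8)[OF d]] .
        ultimately show ?thesis
          using K.Leq_trans[OF _ _ K.Comp_hom[OF K.Comp_hom[OF d0 s(2)] t(2)]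
              K.Comp_hom[OF K.Comp_hom[OF s(1) d1] t(2)] K.Comp_hom[OF K.Comp_hom[OF s(1) t(1)] d2]]
          by (simp add: K.Comp_assoc[OF d0 s(2) t(2)] K.Comp_assoc[OF s(1) d1 t(2)]
              K.Comp_assoc[OF s(1) t(1) d2])
      qed
    qed
  qed
  have obj: "omap \<pi> X \<in> Obj K" if "\<pi> \<in> lax_functors D K" "X \<in> Obj D" for \<pi> X
    using lax_functor.omap_Obj[OF lax_functorsD(1)] that .
  show ?thesis
  proof (intro ordered_category.intro ordered_category_axioms.intro category.intro)
    show "Dom ?L f \<in> Obj ?L" "Cod ?L f \<in> Obj ?L" if "f \<in> Arr ?L" for f
      using that by (simp_all add: lax_functor_category_def)
    show "Idn ?L \<pi> \<in> hom ?L \<pi> \<pi>" if "\<pi> \<in> Obj ?L" for \<pi> using Idn[of \<pi>] that by simp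
    show "g \<odot>\<^bsub>?L\<^esub> f \<in> hom ?L X Z" if "f \<in> hom ?L X Y" "g \<in> hom ?L Y Z" for f g X Y Z
      using Comp[OF that] .
    show "f \<odot>\<^bsub>?L\<^esub> Idn ?L X = f" if f: "f \<in> hom ?L X Y" for f X Y
      using transf_eqI[OF Comp[OF Idn[OF transf_homD(3)[OF f]] f] f] K.Comp_Idn[OF transf_homD(7)[OF f]]
      by simp
    show "Idn ?L Y \<odot>\<^bsub>?L\<^esub> f = f" if f: "f \<in> hom ?L X Y" for f X Y
      using transf_eqI[OF Comp[OF f Idn[OF transf_homD(4)[OF f]]] f] K.Idn_Comp[OF transf_homD(7)[OF f]]
      by simp
    show "(h \<odot>\<^bsub>?L\<^esub> g) \<odot>\<^bsub>?L\<^esub> f = h \<odot>\<^bsub>?L\<^esub> (g \<odot>\<^bsub>?L\<^esub> f)"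
      if f: "f \<in> hom ?L W X" and g: "g \<in> hom ?L X Y" and h: "h \<in> hom ?L Y Z" for f g h W X Y Z
      using K.Comp_assoc[OF transf_homD(7)[OF f] transf_homD(7)[OF g] transf_homD(7)[OF h]]
      by (auto intro: restrict_ext)
    show "partial_order (hom_poset ?L X Y)" for X Y
    proof
      fix f g assume fg: "f \<in> carrier (hom_poset ?L X Y)" "g \<in> carrier (hom_poset ?L X Y)"
        and le: "f \<sqsubseteq>\<^bsub>hom_poset ?L X Y\<^esub> g" "g \<sqsubseteq>\<^bsub>hom_poset ?L X Y\<^esub> f"
      from fg have f: "f \<in> hom ?L X Y" and g: "g \<in> hom ?L X Y" by simp_all
      \<comment> \<open>Antisymmetry in K gives equal components on \<open>Obj D\<close>;
        extensionality turns this into equality of transformations.\<close>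
      have "f = g"
        using transf_eqI[OF f g] K.Leq_antisym[OF _ _ transf_homD(7)[OF f] transf_homD(7)[OF g]] le
        by simp
      then show "f .=\<^bsub>hom_poset ?L X Y\<^esub> g" by (simp add: hom_poset_def)
    next
      fix f assume "f \<in> carrier (hom_poset ?L X Y)"
      then have f: "f \<in> hom ?L X Y" by simp
      show "f \<sqsubseteq>\<^bsub>hom_poset ?L X Y\<^esub> f" using K.Leq_refl[OF transf_homD(7)[OF f]] by simp
    next
      fix f g h assume "f \<in> carrier (hom_poset ?L X Y)" "g \<in> carrier (hom_poset ?L X Y)"
        "h \<in> carrier (hom_poset ?L X Y)"
        and le: "f \<sqsubseteq>\<^bsub>hom_poset ?L X Y\<^esub> g" "g \<sqsubseteq>\<^bsub>hom_poset ?L X Y\<^esub> h"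
      then have f: "f \<in> hom ?L X Y" and g: "g \<in> hom ?L X Y" and h: "h \<in> hom ?L X Y" by simp_all
      show "f \<sqsubseteq>\<^bsub>hom_poset ?L X Y\<^esub> h"
        using K.Leq_trans[OF _ _ transf_homD(7)[OF f] transf_homD(7)[OF g] transf_homD(7)[OF h]] le
        by simp
    qed (auto simp: hom_poset_def)
    show "g \<odot>\<^bsub>?L\<^esub> f \<preceq>\<^bsub>?L\<^esub> g' \<odot>\<^bsub>?L\<^esub> f'"
      if f: "f \<in> hom ?L X Y" and f': "f' \<in> hom ?L X Y" and g: "g \<in> hom ?L Y Z" and g': "g' \<in> hom ?L Y Z"
        and le: "f \<preceq>\<^bsub>?L\<^esub> f'" "g \<preceq>\<^bsub>?L\<^esub> g'" for f f' g g' X Y Z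
      using K.Comp_mono[OF transf_homD(7)[OF f] transf_homD(7)[OF f'] transf_homD(7)[OF g] transf_homD(7)[OF g']] le
      by simp
  qed
qed

section \<open>Change of base as an order preserving functor\<close>

lemma precompose_lax_functors:
  assumes "cat_functor D E p" and \<rho>: "\<rho> \<in> lax_functors E K"
  shows "precompose D p \<rho> \<in> lax_functors D K"
proof -
  interpret p: cat_functor D E p by fact
  interpret \<rho>: lax_functor E K \<rho> using lax_functorsD(1)[OF \<rho>] .
  have "lax_functor D K (precompose D p \<rho>)"
  proof
    fix X assume X: "X \<in> Obj D"
    show "omap (precompose D p \<rho>) X \<in> Obj K"
      using \<rho>.omap_Obj[OF p.omap_Obj[OF X]] X by (simp add: precompose_def)
    show "Idn K (omap (precompose D p \<rho>) X) \<preceq>\<^bsub>K\<^esub> amap (precompose D p \<rho>) (Idn D X)"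
      using \<rho>.lax_Idn[OF p.omap_Obj[OF X]] p.amap_Idn[OF X] X homD(1)[OF p.C.Idn_hom[OF X]]
      by (simp add: precompose_def)
  next
    fix d X Y assume d: "d \<in> hom D X Y"
    show "amap (precompose D p \<rho>) d \<in> hom K (omap (precompose D p \<rho>) X) (omap (precompose D p \<rho>) Y)"
      using \<rho>.amap_hom[OF p.amap_hom[OF d]] p.C.hom_Obj[OF d] homD(1)[OF d] by (simp add: precompose_def)
  next
    fix d\<^sub>2 d\<^sub>1 X Y Z assume d: "d\<^sub>2 \<in> hom D X Y" "d\<^sub>1 \<in> hom D Y Z"
    show "amap (precompose D p \<rho>) d\<^sub>1 \<odot>\<^bsub>K\<^esub> amap (precompose D p \<rho>) d\<^sub>2
        \<preceq>\<^bsub>K\<^esub> amap (precompose D p \<rho>) (d\<^sub>1 \<odot>\<^bsub>D\<^esub> d\<^sub>2)"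
      using \<rho>.lax_Comp[OF p.amap_hom[OF d(1)] p.amap_hom[OF d(2)]] p.amap_Comp[OF d]
        homD(1)[OF d(1)] homD(1)[OF d(2)] homD(1)[OF p.C.Comp_hom[OF d]] by (simp add: precompose_def)
  qed
  then show ?thesis by (simp add: lax_functors_def precompose_def)
qed

lemma ordered_functor_change_of_base:
  assumes "cat_functor D E p"
  shows "ordered_functor (lax_functor_category E K J) (lax_functor_category D K J) (change_of_base D p)"
    (is "ordered_functor ?E ?D ?U")
proof -
  interpret p: cat_functor D E p by fact
  interpret E: ordered_category ?E
    using ordered_category_lax_functor_category[OF p.D.category_axioms] .
  interpret D: ordered_category ?D
    using ordered_category_lax_functor_category[OF p.C.category_axioms] .
  have hom: "amap ?U \<tau> \<in> hom ?D (omap ?U \<rho>) (omap ?U \<rho>')" if \<tau>: "\<tau> \<in> hom ?E \<rho> \<rho>'" for \<tau> \<rho> \<rho>'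
  proof -
    note T = transf_homD[OF \<tau>]
    show ?thesis
      unfolding change_of_base_def cat_map.simps T(1,2)
    proof (rule transf_homI[OF precompose_lax_functors[OF assms T(3)] precompose_lax_functors[OF assms T(4)]])
      show "cmp \<tau> (omap p X) \<in> hom J (omap (precompose D p \<rho>) X) (omap (precompose D p \<rho>') X)"
        if "X \<in> Obj D" for X
        using T(6)[OF p.omap_Obj[OF that]] that by (simp add: precompose_def)
      show "cmp \<tau> (omap p Y) \<odot>\<^bsub>K\<^esub> amap (precompose D p \<rho>) d
          \<preceq>\<^bsub>K\<^esub> amap (precompose D p \<rho>') d \<odot>\<^bsub>K\<^esub> cmp \<tau> (omap p X)"
        if "d \<in> hom D X Y" for d X Y
        using T(8)[OF p.amap_hom[OF that]] homD(1)[OF that] by (simp add: precompose_def)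
    qed
  qed
  show ?thesis
  proof
    show "omap ?U \<rho> \<in> Obj ?D" if "\<rho> \<in> Obj ?E" for \<rho>
      using precompose_lax_functors[OF assms] that by (simp add: change_of_base_def)
    show "amap ?U f \<in> hom ?D (omap ?U A) (omap ?U B)" if "f \<in> hom ?E A B" for f A B
      using hom[OF that] .
    \<comment> \<open>Both functor laws hold by comparing components; \<open>p.omap_Obj\<close>
      allows a family restricted to \<open>Obj E\<close> to be evaluated at
      \<open>omap p X\<close>.\<close>
    show "amap ?U (Idn ?E \<rho>) = Idn ?D (omap ?U \<rho>)" for \<rho>
      by (auto simp: change_of_base_def precompose_def p.omap_Obj intro: restrict_ext)
    show "amap ?U (g \<odot>\<^bsub>?E\<^esub> f) = amap ?U g \<odot>\<^bsub>?D\<^esub> amap ?U f" for f g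
      by (auto simp: change_of_base_def p.omap_Obj intro: restrict_ext)
    fix X Y assume XY: "X \<in> Obj ?E" "Y \<in> Obj ?E"
    then have UXY: "omap ?U X \<in> Obj ?D" "omap ?U Y \<in> Obj ?D"
      using precompose_lax_functors[OF assms] by (simp_all add: change_of_base_def)
    show "isotone (hom_poset ?E X Y) (hom_poset ?D (omap ?U X) (omap ?U Y)) (amap ?U)"
      using E.hom_partial_order[OF XY] D.hom_partial_order[OF UXY]
      by (auto simp: isotone_def partial_order_def change_of_base_def p.omap_Obj)
  qed
qed

end

section \<open>The left Kan extension along \<open>p\<close>\<close>

context sup_enriched_category
begin

text \<open>Together with \<open>sup_Comp_least\<close>, this is the form in which Sup-enrichment
  enters the construction: a composite with a supremum is bounded as soon as the composites with the
  members are.\<close>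

lemma Comp_sup_least:
  assumes G: "G \<subseteq> hom K X Y" and XY: "X \<in> Obj K" "Y \<in> Obj K"
    and g: "g \<in> hom K Y Z" and h: "h \<in> hom K X Z" and le: "\<And>f. f \<in> G \<Longrightarrow> g \<odot> f \<preceq> h"
  shows "g \<odot> \<Squnion>\<^bsub>hom_poset K X Y\<^esub> G \<preceq> h"
proof -
  have "(\<lambda>f. g \<odot> f) ` G \<subseteq> hom K X Z" using G Comp_hom[OF _ g] by blast
  from sup_least[OF this h] show ?thesis
    unfolding Comp_sup_right[OF XY hom_Obj(2)[OF g] g G] using le by auto
qed

lemma sup_Comp_least:
  assumes G: "G \<subseteq> hom K Y Z" and YZ: "Y \<in> Obj K" "Z \<in> Obj K"
    and f: "f \<in> hom K X Y" and h: "h \<in> hom K X Z" and le: "\<And>g. g \<in> G \<Longrightarrow> g \<odot> f \<preceq> h"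
  shows "(\<Squnion>\<^bsub>hom_poset K Y Z\<^esub> G) \<odot> f \<preceq> h"
proof -
  have "(\<lambda>g. g \<odot> f) ` G \<subseteq> hom K X Z" using G Comp_hom[OF f] by blast
  from sup_least[OF this h] show ?thesis
    unfolding Comp_sup_left[OF hom_Obj(1)[OF f] YZ G f] using le by auto
qed

end

text \<open>Each object of \<open>D\<close> lies in exactly one fibre, so a single family \<iota>
  indexed by objects of \<open>D\<close> holds the injections of all the coproducts. The arrow
  \<open>m d\<close> is specified by its composites with the injections, as a cotuple is. Where no
  lift of \<open>d\<close> starts at \<open>X\<close>, the supremum is empty and the component is
  the bottom; over an object outside the image of \<open>p\<close>, the coproduct is an initial
  object.\<close>

locale left_kan_extension =
  ordered_wide_subcategory J K + K: sup_enriched_category K + p: cat_functor D E p + \<pi>: lax_functor D K \<pi>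
  for J :: "('o, 'a, 'm) category_scheme" and K :: "('o, 'a, 'n) ocategory_scheme"
    and D :: "('d, 'da, 'k) category_scheme" and E :: "('e, 'ea, 'l) category_scheme"
    and p :: "('d, 'da, 'e, 'ea) cat_map" and \<pi> :: "('d, 'da, 'o, 'a) cat_map" +
  fixes S :: "'e \<Rightarrow> 'o" and \<iota> :: "'d \<Rightarrow> 'a" and m :: "'ea \<Rightarrow> 'a"
  assumes \<pi>_ext: "\<pi> \<in> lax_functors D K"
    and S_coproduct: "e \<in> Obj E \<Longrightarrow> ordered_coproduct J K {X\<in>Obj D. omap p X = e} (omap \<pi>) (S e) \<iota>"
    and m_hom: "d \<in> hom E e e' \<Longrightarrow> m d \<in> hom K (S e) (S e')"
    and m_\<iota>: "\<lbrakk>d \<in> hom E (omap p X) e'; X \<in> Obj D\<rbrakk> \<Longrightarrow>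
      m d \<odot>\<^bsub>K\<^esub> \<iota> X = \<Squnion>\<^bsub>hom_poset K (omap \<pi> X) (S e')\<^esub> {\<iota> Y \<odot>\<^bsub>K\<^esub> amap \<pi> c | c Y. c \<in> hom D X Y \<and> amap p c = d}"
begin

lemma S_Obj: "e \<in> Obj E \<Longrightarrow> S e \<in> Obj K"
  using ordered_coproductD(1)[OF S_coproduct] .

lemma \<iota>_hom_J: "X \<in> Obj D \<Longrightarrow> \<iota> X \<in> hom J (omap \<pi> X) (S (omap p X))"
  using ordered_coproductD(2)[OF S_coproduct[OF p.omap_Obj]] by simp

lemmas \<iota>_hom = hom_sub[OF \<iota>_hom_J]

lemma Leq_if_Leq_\<iota>:
  assumes "f \<in> hom K (S e) Y" "g \<in> hom K (S e) Y" "e \<in> Obj E"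
    and "\<And>X. \<lbrakk>X \<in> Obj D; omap p X = e\<rbrakk> \<Longrightarrow> f \<odot>\<^bsub>K\<^esub> \<iota> X \<preceq>\<^bsub>K\<^esub> g \<odot>\<^bsub>K\<^esub> \<iota> X"
  shows "f \<preceq>\<^bsub>K\<^esub> g"
  using ordered_coproductD(6)[OF S_coproduct[OF assms(3)] assms(1,2) K.hom_Obj(2)[OF assms(1)]] assms(4)
  by simp

lemma over:
  assumes "c \<in> hom D X Y" "amap p c = d" "d \<in> hom E e e'"
  shows "omap p X = e" "omap p Y = e'"
  using homD[OF p.amap_hom[OF assms(1)]] homD[OF assms(3)] assms(2) by auto

section \<open>The values on arrows, their bounds and their laxness\<close>

lemma m_summands:
  assumes "d \<in> hom E (omap p X) e'"
  shows "{\<iota> Y \<odot>\<^bsub>K\<^esub> amap \<pi> c | c Y. c \<in> hom D X Y \<and> amap p c = d} \<subseteq> hom K (omap \<pi> X) (S e')"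
proof -
  have "\<iota> Y \<odot>\<^bsub>K\<^esub> amap \<pi> c \<in> hom K (omap \<pi> X) (S e')" if c: "c \<in> hom D X Y" "amap p c = d" for c Y
    using K.Comp_hom[OF \<pi>.amap_hom[OF c(1)] \<iota>_hom[OF p.C.hom_Obj(2)[OF c(1)]]] over(2)[OF c assms] by simp
  then show ?thesis by auto
qed

text \<open>This is the oplax square of the future unit \<iota> at \<open>c\<close>. The supremum
  makes \<open>m\<close> the smallest family of arrows satisfying it.\<close>

lemma m_upper:
  assumes c: "c \<in> hom D X Y"
  shows "\<iota> Y \<odot>\<^bsub>K\<^esub> amap \<pi> c \<preceq>\<^bsub>K\<^esub> m (amap p c) \<odot>\<^bsub>K\<^esub> \<iota> X"
proof -
  note d = p.amap_hom[OF c] and X = p.C.hom_Obj(1)[OF c]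
  show ?thesis
    unfolding m_\<iota>[OF d X]
    using K.sup_upper[OF m_summands[OF d] \<pi>.omap_Obj[OF X] S_Obj[OF p.D.hom_Obj(2)[OF d]]] c by blast
qed

text \<open>The supremum defining \<open>m d\<close> is moved out past a postcomposed arrow, leaving
  one inequality for each lift of \<open>d\<close>. The lemma \<open>m_Comp_least\<close> does the
  same past a precomposed arrow; composites of two values of \<open>m\<close> require both.\<close>

lemma Comp_m_least:
  assumes d: "d \<in> hom E (omap p X) e'" and X: "X \<in> Obj D"
    and g: "g \<in> hom K (S e') Z" and h: "h \<in> hom K (omap \<pi> X) Z"
    and le: "\<And>c Y. \<lbrakk>c \<in> hom D X Y; amap p c = d\<rbrakk> \<Longrightarrow> g \<odot>\<^bsub>K\<^esub> (\<iota> Y \<odot>\<^bsub>K\<^esub> amap \<pi> c) \<preceq>\<^bsub>K\<^esub> h"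
  shows "g \<odot>\<^bsub>K\<^esub> m d \<odot>\<^bsub>K\<^esub> \<iota> X \<preceq>\<^bsub>K\<^esub> h"
proof -
  have "g \<odot>\<^bsub>K\<^esub> m d \<odot>\<^bsub>K\<^esub> \<iota> X = g \<odot>\<^bsub>K\<^esub> (m d \<odot>\<^bsub>K\<^esub> \<iota> X)"
    using K.Comp_assoc[OF \<iota>_hom[OF X] m_hom[OF d] g] .
  also have "\<dots> \<preceq>\<^bsub>K\<^esub> h"
    unfolding m_\<iota>[OF d X]
    using K.Comp_sup_least[OF m_summands[OF d] \<pi>.omap_Obj[OF X] S_Obj[OF p.D.hom_Obj(2)[OF d]] g h] le
    by blast
  finally show ?thesis .
qed

lemma m_Comp_least:
  assumes d: "d \<in> hom E (omap p X) e'" and X: "X \<in> Obj D"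
    and f: "f \<in> hom K W (omap \<pi> X)" and h: "h \<in> hom K W (S e')"
    and le: "\<And>c Y. \<lbrakk>c \<in> hom D X Y; amap p c = d\<rbrakk> \<Longrightarrow> \<iota> Y \<odot>\<^bsub>K\<^esub> amap \<pi> c \<odot>\<^bsub>K\<^esub> f \<preceq>\<^bsub>K\<^esub> h"
  shows "m d \<odot>\<^bsub>K\<^esub> \<iota> X \<odot>\<^bsub>K\<^esub> f \<preceq>\<^bsub>K\<^esub> h"
  unfolding m_\<iota>[OF d X]
  using K.sup_Comp_least[OF m_summands[OF d] \<pi>.omap_Obj[OF X] S_Obj[OF p.D.hom_Obj(2)[OF d]] f h] le
  by blast

text \<open>The identity of \<open>X\<close> is among the lifts of the identity of \<open>e\<close>,
  and laxness of \<pi> compares its summand with \<iota> itself. The other arrows within the fibre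
  contribute summands as well, so equality cannot be expected.\<close>

lemma m_Idn:
  assumes e: "e \<in> Obj E"
  shows "Idn K (S e) \<preceq>\<^bsub>K\<^esub> m (Idn E e)"
proof (rule Leq_if_Leq_\<iota>[OF K.Idn_hom[OF S_Obj[OF e]] m_hom[OF p.D.Idn_hom[OF e]] e])
  fix X assume X: "X \<in> Obj D" and pX: "omap p X = e"
  note IX = p.C.Idn_hom[OF X] and IK = K.Idn_hom[OF \<pi>.omap_Obj[OF X]]
  have \<iota>X: "\<iota> X \<in> hom K (omap \<pi> X) (S e)" using \<iota>_hom[OF X] pX by simp
  have "\<iota> X \<odot>\<^bsub>K\<^esub> Idn K (omap \<pi> X) \<preceq>\<^bsub>K\<^esub> \<iota> X \<odot>\<^bsub>K\<^esub> amap \<pi> (Idn D X)"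
    using K.Comp_mono[OF IK \<pi>.amap_hom[OF IX] \<iota>X \<iota>X \<pi>.lax_Idn[OF X] K.Leq_refl[OF \<iota>X]] .
  moreover have "\<iota> X \<odot>\<^bsub>K\<^esub> amap \<pi> (Idn D X) \<preceq>\<^bsub>K\<^esub> m (Idn E e) \<odot>\<^bsub>K\<^esub> \<iota> X"
    using m_upper[OF IX] p.amap_Idn[OF X] pX by simp
  ultimately show "Idn K (S e) \<odot>\<^bsub>K\<^esub> \<iota> X \<preceq>\<^bsub>K\<^esub> m (Idn E e) \<odot>\<^bsub>K\<^esub> \<iota> X"
    using K.Leq_trans[OF _ _ \<iota>X K.Comp_hom[OF \<pi>.amap_hom[OF IX] \<iota>X]
        K.Comp_hom[OF \<iota>X m_hom[OF p.D.Idn_hom[OF e]]]]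
      K.Comp_Idn[OF \<iota>X] K.Idn_Comp[OF \<iota>X] by simp
qed

text \<open>For lifts \<open>c\<^sub>2\<close> of \<open>d\<^sub>2\<close> and
  \<open>c\<^sub>1\<close> of \<open>d\<^sub>1\<close> that are composable, laxness of \<pi> puts
  their contribution below the summand of the composite lift.\<close>

lemma m_Comp:
  assumes d2: "d\<^sub>2 \<in> hom E e e'" and d1: "d\<^sub>1 \<in> hom E e' e''"
  shows "m d\<^sub>1 \<odot>\<^bsub>K\<^esub> m d\<^sub>2 \<preceq>\<^bsub>K\<^esub> m (d\<^sub>1 \<odot>\<^bsub>E\<^esub> d\<^sub>2)"
proof (rule Leq_if_Leq_\<iota>[OF K.Comp_hom[OF m_hom[OF d2] m_hom[OF d1]] m_hom[OF p.D.Comp_hom[OF d2 d1]]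
      p.D.hom_Obj(1)[OF d2]])
  fix X assume X: "X \<in> Obj D" and pX: "omap p X = e"
  have \<iota>X: "\<iota> X \<in> hom K (omap \<pi> X) (S e)" using \<iota>_hom[OF X] pX by simp
  note t = K.Comp_hom[OF \<iota>X m_hom[OF p.D.Comp_hom[OF d2 d1]]]
  have d2': "d\<^sub>2 \<in> hom E (omap p X) e'" using d2 pX by simp
  show "m d\<^sub>1 \<odot>\<^bsub>K\<^esub> m d\<^sub>2 \<odot>\<^bsub>K\<^esub> \<iota> X \<preceq>\<^bsub>K\<^esub> m (d\<^sub>1 \<odot>\<^bsub>E\<^esub> d\<^sub>2) \<odot>\<^bsub>K\<^esub> \<iota> X"
  proof (rule Comp_m_least[OF d2' X m_hom[OF d1] t])
    fix c\<^sub>2 Y assume c2: "c\<^sub>2 \<in> hom D X Y" and pc2: "amap p c\<^sub>2 = d\<^sub>2"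
    note Y = p.C.hom_Obj(2)[OF c2] and \<pi>c2 = \<pi>.amap_hom[OF c2] and pY = over(2)[OF c2 pc2 d2]
    have \<iota>Y: "\<iota> Y \<in> hom K (omap \<pi> Y) (S e')" using \<iota>_hom[OF Y] pY by simp
    have d1': "d\<^sub>1 \<in> hom E (omap p Y) e''" using d1 pY by simp
    \<comment> \<open>The supremum in \<open>m d\<^sub>2\<close> has been dealt with. The one in
      \<open>m d\<^sub>1\<close> runs over lifts starting at \<open>Y\<close>, the target of the
      chosen \<open>c\<^sub>2\<close>, and is now moved past
      \<open>amap \<pi> c\<^sub>2\<close>.\<close>
    have "m d\<^sub>1 \<odot>\<^bsub>K\<^esub> \<iota> Y \<odot>\<^bsub>K\<^esub> amap \<pi> c\<^sub>2 \<preceq>\<^bsub>K\<^esub> m (d\<^sub>1 \<odot>\<^bsub>E\<^esub> d\<^sub>2) \<odot>\<^bsub>K\<^esub> \<iota> X"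
    proof (rule m_Comp_least[OF d1' Y \<pi>c2 t])
      fix c\<^sub>1 Z assume c1: "c\<^sub>1 \<in> hom D Y Z" and pc1: "amap p c\<^sub>1 = d\<^sub>1"
      note Z = p.C.hom_Obj(2)[OF c1] and \<pi>c1 = \<pi>.amap_hom[OF c1] and pZ = over(2)[OF c1 pc1 d1]
      note c12 = p.C.Comp_hom[OF c2 c1]
      have \<iota>Z: "\<iota> Z \<in> hom K (omap \<pi> Z) (S e'')" using \<iota>_hom[OF Z] pZ by simp
      have "\<iota> Z \<odot>\<^bsub>K\<^esub> (amap \<pi> c\<^sub>1 \<odot>\<^bsub>K\<^esub> amap \<pi> c\<^sub>2) \<preceq>\<^bsub>K\<^esub> \<iota> Z \<odot>\<^bsub>K\<^esub> amap \<pi> (c\<^sub>1 \<odot>\<^bsub>D\<^esub> c\<^sub>2)"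
        using K.Comp_mono[OF K.Comp_hom[OF \<pi>c2 \<pi>c1] \<pi>.amap_hom[OF c12] \<iota>Z \<iota>Z
            \<pi>.lax_Comp[OF c2 c1] K.Leq_refl[OF \<iota>Z]] .
      moreover have "\<iota> Z \<odot>\<^bsub>K\<^esub> amap \<pi> (c\<^sub>1 \<odot>\<^bsub>D\<^esub> c\<^sub>2) \<preceq>\<^bsub>K\<^esub> m (d\<^sub>1 \<odot>\<^bsub>E\<^esub> d\<^sub>2) \<odot>\<^bsub>K\<^esub> \<iota> X"
        using m_upper[OF c12] p.amap_Comp[OF c2 c1] pc1 pc2 by simp
      ultimately show "\<iota> Z \<odot>\<^bsub>K\<^esub> amap \<pi> c\<^sub>1 \<odot>\<^bsub>K\<^esub> amap \<pi> c\<^sub>2 \<preceq>\<^bsub>K\<^esub> m (d\<^sub>1 \<odot>\<^bsub>E\<^esub> d\<^sub>2) \<odot>\<^bsub>K\<^esub> \<iota> X"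
        using K.Leq_trans[OF _ _ K.Comp_hom[OF K.Comp_hom[OF \<pi>c2 \<pi>c1] \<iota>Z]
            K.Comp_hom[OF \<pi>.amap_hom[OF c12] \<iota>Z] t]
          K.Comp_assoc[OF \<pi>c2 \<pi>c1 \<iota>Z] by simp
    qed
    then show "m d\<^sub>1 \<odot>\<^bsub>K\<^esub> (\<iota> Y \<odot>\<^bsub>K\<^esub> amap \<pi> c\<^sub>2) \<preceq>\<^bsub>K\<^esub> m (d\<^sub>1 \<odot>\<^bsub>E\<^esub> d\<^sub>2) \<odot>\<^bsub>K\<^esub> \<iota> X"
      using K.Comp_assoc[OF \<pi>c2 \<iota>Y m_hom[OF d1]] by simp
  qed
qed

section \<open>The extension as a lax functor, its unit and transposition\<close>

definition kan :: "('e, 'ea, 'o, 'a) cat_map" where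
  "kan = \<lparr>omap = (\<lambda>e\<in>Obj E. S e), amap = (\<lambda>d\<in>Arr E. m d)\<rparr>"

lemma omap_kan: "e \<in> Obj E \<Longrightarrow> omap kan e = S e"
  by (simp add: kan_def)

lemma amap_kan: "d \<in> hom E e e' \<Longrightarrow> amap kan d = m d"
  using homD(1)[of d E e e'] by (simp add: kan_def)

lemma kan_lax: "kan \<in> lax_functors E K"
proof -
  have "lax_functor E K kan"
  proof
    show "omap kan e \<in> Obj K" if "e \<in> Obj E" for e
      using S_Obj that by (simp add: omap_kan)
    show "amap kan d \<in> hom K (omap kan e) (omap kan e')" if "d \<in> hom E e e'" for d e e'
      using m_hom[OF that] amap_kan[OF that] p.D.hom_Obj[OF that] by (simp add: omap_kan)
    show "Idn K (omap kan e) \<preceq>\<^bsub>K\<^esub> amap kan (Idn E e)" if "e \<in> Obj E" for e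
      using m_Idn[OF that] that amap_kan[OF p.D.Idn_hom[OF that]] by (simp add: omap_kan)
    show "amap kan d\<^sub>1 \<odot>\<^bsub>K\<^esub> amap kan d\<^sub>2 \<preceq>\<^bsub>K\<^esub> amap kan (d\<^sub>1 \<odot>\<^bsub>E\<^esub> d\<^sub>2)"
      if "d\<^sub>2 \<in> hom E e e'" "d\<^sub>1 \<in> hom E e' e''" for d\<^sub>2 d\<^sub>1 e e' e''
      using m_Comp[OF that] amap_kan[OF that(1)] amap_kan[OF that(2)] amap_kan[OF p.D.Comp_hom[OF that]]
      by simp
  qed
  then show ?thesis by (simp add: lax_functors_def kan_def)
qed

definition unit :: "('d, 'da, 'o, 'a) transf" where
  "unit = \<lparr>src = \<pi>, tgt = precompose D p kan, cmp = (\<lambda>X\<in>Obj D. \<iota> X)\<rparr>"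

lemma unit_hom: "unit \<in> hom (lax_functor_category D K J) \<pi> (precompose D p kan)"
  unfolding unit_def
proof (rule transf_homI[OF \<pi>_ext precompose_lax_functors[OF p.cat_functor_axioms kan_lax]])
  show "\<iota> X \<in> hom J (omap \<pi> X) (omap (precompose D p kan) X)" if "X \<in> Obj D" for X
    using \<iota>_hom_J[OF that] that by (simp add: precompose_def omap_kan p.omap_Obj)
  show "\<iota> Y \<odot>\<^bsub>K\<^esub> amap \<pi> c \<preceq>\<^bsub>K\<^esub> amap (precompose D p kan) c \<odot>\<^bsub>K\<^esub> \<iota> X" if "c \<in> hom D X Y" for c X Y
    using m_upper[OF that] homD(1)[OF that] amap_kan[OF p.amap_hom[OF that]] by (simp add: precompose_def)
qed

lemma cmp_change_of_base_unit:
  "X \<in> Obj D \<Longrightarrow> cmp (amap (change_of_base D p) g \<odot>\<^bsub>lax_functor_category D K J\<^esub> unit) X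
     = cmp g (omap p X) \<odot>\<^bsub>K\<^esub> \<iota> X"
  by (simp add: change_of_base_def unit_def)

text \<open>On each fibre the components of \<open>f\<close> are cotupled in J, so the result has
  components in J. Its oplaxity at \<open>d\<close>, tested on an injection and a lift
  \<open>c\<close> of \<open>d\<close>, becomes oplaxity of \<open>f\<close> at
  \<open>c\<close>.\<close>

lemma transpose_exists:
  assumes \<rho>: "\<rho> \<in> lax_functors E K"
    and f: "f \<in> hom (lax_functor_category D K J) \<pi> (precompose D p \<rho>)"
  shows "\<exists>g\<in>hom (lax_functor_category E K J) kan \<rho>.
    amap (change_of_base D p) g \<odot>\<^bsub>lax_functor_category D K J\<^esub> unit = f"
proof -
  interpret \<rho>: lax_functor E K \<rho> using lax_functorsD(1)[OF \<rho>] .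
  note f' = transf_homD[OF f]
  have fX: "cmp f X \<in> hom J (omap \<pi> X) (omap \<rho> (omap p X))" if "X \<in> Obj D" for X
    using f'(6)[OF that] that by (simp add: precompose_def)
  have "\<exists>h\<in>hom J (S e) (omap \<rho> e). \<forall>X\<in>{X\<in>Obj D. omap p X = e}. h \<odot>\<^bsub>J\<^esub> \<iota> X = cmp f X"
    if e: "e \<in> Obj E" for e
    using fX \<rho>.omap_Obj[OF e] Obj_eq by (intro ordered_coproductD(5)[OF S_coproduct[OF e]]) auto
  then have "\<forall>e. \<exists>h. e \<in> Obj E \<longrightarrow> h \<in> hom J (S e) (omap \<rho> e) \<and>
      (\<forall>X\<in>{X\<in>Obj D. omap p X = e}. h \<odot>\<^bsub>J\<^esub> \<iota> X = cmp f X)"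
    by blast
  then obtain h where "\<forall>e. e \<in> Obj E \<longrightarrow> h e \<in> hom J (S e) (omap \<rho> e) \<and>
      (\<forall>X\<in>{X\<in>Obj D. omap p X = e}. h e \<odot>\<^bsub>J\<^esub> \<iota> X = cmp f X)"
    by (rule choice[THEN exE])
  then have hJ: "h e \<in> hom J (S e) (omap \<rho> e)"
    and "\<And>X. \<lbrakk>X \<in> Obj D; omap p X = e\<rbrakk> \<Longrightarrow> h e \<odot>\<^bsub>J\<^esub> \<iota> X = cmp f X" if "e \<in> Obj E" for e
    using that by auto
  then have h\<iota>: "h (omap p X) \<odot>\<^bsub>K\<^esub> \<iota> X = cmp f X" if "X \<in> Obj D" for X
    using Comp_eq[OF \<iota>_hom_J[OF that] hJ] p.omap_Obj[OF that] that by metis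
  note h = hom_sub[OF hJ]
  define g where "g = \<lparr>src = kan, tgt = \<rho>, cmp = (\<lambda>e\<in>Obj E. h e)\<rparr>"
  have g: "g \<in> hom (lax_functor_category E K J) kan \<rho>"
    unfolding g_def
  proof (rule transf_homI[OF kan_lax \<rho>])
    show "h e \<in> hom J (omap kan e) (omap \<rho> e)" if "e \<in> Obj E" for e
      using hJ[OF that] that by (simp add: omap_kan)
  next
    fix d e e' assume d: "d \<in> hom E e e'"
    note e = p.D.hom_Obj[OF d] and \<rho>d = \<rho>.amap_hom[OF d]
    have "h e' \<odot>\<^bsub>K\<^esub> m d \<preceq>\<^bsub>K\<^esub> amap \<rho> d \<odot>\<^bsub>K\<^esub> h e"
    proof (rule Leq_if_Leq_\<iota>[OF K.Comp_hom[OF m_hom[OF d] h[OF e(2)]] K.Comp_hom[OF h[OF e(1)] \<rho>d] e(1)])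
      fix X assume X: "X \<in> Obj D" and pX: "omap p X = e"
      have \<iota>X: "\<iota> X \<in> hom K (omap \<pi> X) (S e)" using \<iota>_hom[OF X] pX by simp
      have d': "d \<in> hom E (omap p X) e'" using d pX by simp
      have t: "amap \<rho> d \<odot>\<^bsub>K\<^esub> h e \<odot>\<^bsub>K\<^esub> \<iota> X = amap \<rho> d \<odot>\<^bsub>K\<^esub> cmp f X"
        using K.Comp_assoc[OF \<iota>X h[OF e(1)] \<rho>d] h\<iota>[OF X] pX by simp
      show "h e' \<odot>\<^bsub>K\<^esub> m d \<odot>\<^bsub>K\<^esub> \<iota> X \<preceq>\<^bsub>K\<^esub> amap \<rho> d \<odot>\<^bsub>K\<^esub> h e \<odot>\<^bsub>K\<^esub> \<iota> X"
      proof (rule Comp_m_least[OF d' X h[OF e(2)] K.Comp_hom[OF \<iota>X K.Comp_hom[OF h[OF e(1)] \<rho>d]]])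
        fix c Y assume c: "c \<in> hom D X Y" and pc: "amap p c = d"
        note Y = p.C.hom_Obj(2)[OF c] and pY = over(2)[OF c pc d]
        have \<iota>Y: "\<iota> Y \<in> hom K (omap \<pi> Y) (S e')" using \<iota>_hom[OF Y] pY by simp
        have "h e' \<odot>\<^bsub>K\<^esub> (\<iota> Y \<odot>\<^bsub>K\<^esub> amap \<pi> c) = cmp f Y \<odot>\<^bsub>K\<^esub> amap \<pi> c"
          using K.Comp_assoc[OF \<pi>.amap_hom[OF c] \<iota>Y h[OF e(2)]] h\<iota>[OF Y] pY by simp
        also have "\<dots> \<preceq>\<^bsub>K\<^esub> amap \<rho> d \<odot>\<^bsub>K\<^esub> cmp f X"
          using f'(8)[OF c] homD(1)[OF c] pc by (simp add: precompose_def)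
        finally show "h e' \<odot>\<^bsub>K\<^esub> (\<iota> Y \<odot>\<^bsub>K\<^esub> amap \<pi> c) \<preceq>\<^bsub>K\<^esub> amap \<rho> d \<odot>\<^bsub>K\<^esub> h e \<odot>\<^bsub>K\<^esub> \<iota> X"
          unfolding t .
      qed
    qed
    then show "h e' \<odot>\<^bsub>K\<^esub> amap kan d \<preceq>\<^bsub>K\<^esub> amap \<rho> d \<odot>\<^bsub>K\<^esub> h e"
      unfolding amap_kan[OF d] .
  qed
  have "amap (change_of_base D p) g \<odot>\<^bsub>lax_functor_category D K J\<^esub> unit = f" (is "?l = f")
  proof (rule transf.equality)
    show "src ?l = src f" "tgt ?l = tgt f"
      using f'(1,2) by (simp_all add: unit_def change_of_base_def g_def)
    show "cmp ?l = cmp f"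
    proof (rule extensionalityI[OF _ f'(5)])
      show "cmp ?l X = cmp f X" if "X \<in> Obj D" for X
        using h\<iota>[OF that] p.omap_Obj[OF that] unfolding cmp_change_of_base_unit[OF that] by (simp add: g_def)
    qed simp
  qed simp
  with g show ?thesis by blast
qed

lemma transpose_reflects_order:
  assumes g: "g \<in> hom (lax_functor_category E K J) kan \<rho>"
    and g': "g' \<in> hom (lax_functor_category E K J) kan \<rho>"
    and le: "amap (change_of_base D p) g \<odot>\<^bsub>lax_functor_category D K J\<^esub> unit
      \<preceq>\<^bsub>lax_functor_category D K J\<^esub> amap (change_of_base D p) g' \<odot>\<^bsub>lax_functor_category D K J\<^esub> unit"
  shows "g \<preceq>\<^bsub>lax_functor_category E K J\<^esub> g'"
proof -
  have "cmp g e \<preceq>\<^bsub>K\<^esub> cmp g' e" if e: "e \<in> Obj E" for e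
  proof (rule Leq_if_Leq_\<iota>[OF _ _ e])
    show "cmp g e \<in> hom K (S e) (omap \<rho> e)" "cmp g' e \<in> hom K (S e) (omap \<rho> e)"
      using transf_homD(7)[OF g e] transf_homD(7)[OF g' e] e by (simp_all add: omap_kan)
    show "cmp g e \<odot>\<^bsub>K\<^esub> \<iota> X \<preceq>\<^bsub>K\<^esub> cmp g' e \<odot>\<^bsub>K\<^esub> \<iota> X" if "X \<in> Obj D" "omap p X = e" for X
      using le that by (auto simp: change_of_base_def unit_def)
  qed
  then show ?thesis by simp
qed

end

section \<open>Existence of the extension and conclusion\<close>

lemma (in ordered_wide_subcategory) left_kan_extension_exists:
  fixes p :: "('d, 'da, 'e, 'ea) cat_map"
  assumes K: "sup_enriched_category K" and p: "cat_functor D E p" and \<pi>: "\<pi> \<in> lax_functors D K"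
    and coproducts: "\<And>e. e \<in> Obj E \<Longrightarrow>
      \<exists>S \<iota>. ordered_coproduct J K {X\<in>Obj D. omap p X = e} (omap \<pi>) S \<iota>"
  shows "\<exists>S \<iota> m. left_kan_extension J K D E p \<pi> S \<iota> m"
proof -
  interpret K: sup_enriched_category K by (rule K)
  interpret p: cat_functor D E p by (rule p)
  interpret \<pi>: lax_functor D K \<pi> using lax_functorsD(1)[OF \<pi>] .
  have "\<forall>e. \<exists>S \<iota>. e \<in> Obj E \<longrightarrow> ordered_coproduct J K {X\<in>Obj D. omap p X = e} (omap \<pi>) S \<iota>"
    using coproducts by blast
  then obtain S \<iota>' where S': "\<And>e. e \<in> Obj E \<Longrightarrow>
      ordered_coproduct J K {X\<in>Obj D. omap p X = e} (omap \<pi>) (S e) (\<iota>' e)"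
    by metis
  \<comment> \<open>The injections chosen fibre by fibre are glued into one family; over
    \<open>e\<close> it agrees with \<open>\<iota>' e\<close>.\<close>
  define \<iota> where "\<iota> X = \<iota>' (omap p X) X" for X
  have S: "ordered_coproduct J K {X\<in>Obj D. omap p X = e} (omap \<pi>) (S e) \<iota>" if "e \<in> Obj E" for e
    using S'[OF that] by (simp add: ordered_coproduct_def is_coproduct_def \<iota>_def)
  define G where "G d X = {\<iota> Y \<odot>\<^bsub>K\<^esub> amap \<pi> c | c Y. c \<in> hom D X Y \<and> amap p c = d}" for d X
  \<comment> \<open>Every element of \<open>G d X\<close> comes with a lift of \<open>d\<close>,
    whose typing yields the codomain of \<open>d\<close>; hence the inclusion for arbitrary
    \<open>d\<close> and \<open>X\<close>.\<close>
  have G: "G d X \<subseteq> hom K (omap \<pi> X) (S (Cod E d))" for d X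
  proof -
    have "\<iota> Y \<odot>\<^bsub>K\<^esub> amap \<pi> c \<in> hom K (omap \<pi> X) (S (Cod E d))" if c: "c \<in> hom D X Y" "amap p c = d" for c Y
      using K.Comp_hom[OF \<pi>.amap_hom[OF c(1)] ordered_coproductD(3)[OF S[OF p.omap_Obj]]]
        homD(3)[OF p.amap_hom[OF c(1)]] c(2) p.C.hom_Obj(2)[OF c(1)] by simp
    then show ?thesis by (auto simp: G_def)
  qed
  \<comment> \<open>Here the universal property in K is used, since the suprema to be cotupled need
    not belong to J.\<close>
  have "\<exists>m\<in>hom K (S (Dom E d)) (S (Cod E d)). \<forall>X\<in>{X\<in>Obj D. omap p X = Dom E d}.
      m \<odot>\<^bsub>K\<^esub> \<iota> X = \<Squnion>\<^bsub>hom_poset K (omap \<pi> X) (S (Cod E d))\<^esub> (G d X)" if d: "d \<in> Arr E" for d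
    using K.sup_hom[OF G \<pi>.omap_Obj] ordered_coproductD(1)[OF S[OF p.D.Cod_Obj[OF d]]]
    by (intro ordered_coproductD(4)[OF S[OF p.D.Dom_Obj[OF d]]]) auto
  then have "\<forall>d. \<exists>m. d \<in> Arr E \<longrightarrow> m \<in> hom K (S (Dom E d)) (S (Cod E d)) \<and>
      (\<forall>X\<in>{X\<in>Obj D. omap p X = Dom E d}.
        m \<odot>\<^bsub>K\<^esub> \<iota> X = \<Squnion>\<^bsub>hom_poset K (omap \<pi> X) (S (Cod E d))\<^esub> (G d X))"
    by blast
  then obtain m where m: "\<forall>d. d \<in> Arr E \<longrightarrow> m d \<in> hom K (S (Dom E d)) (S (Cod E d)) \<and>
      (\<forall>X\<in>{X\<in>Obj D. omap p X = Dom E d}.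
        m d \<odot>\<^bsub>K\<^esub> \<iota> X = \<Squnion>\<^bsub>hom_poset K (omap \<pi> X) (S (Cod E d))\<^esub> (G d X))"
    by (rule choice[THEN exE])
  have "left_kan_extension J K D E p \<pi> S \<iota> m"
  proof
    show "\<pi> \<in> lax_functors D K" by (rule \<pi>)
    show "ordered_coproduct J K {X\<in>Obj D. omap p X = e} (omap \<pi>) (S e) \<iota>" if "e \<in> Obj E" for e
      using S[OF that] .
    show "m d \<in> hom K (S e) (S e')" if "d \<in> hom E e e'" for d e e'
      using m homD[OF that] by auto
    show "m d \<odot>\<^bsub>K\<^esub> \<iota> X = \<Squnion>\<^bsub>hom_poset K (omap \<pi> X) (S e')\<^esub>
        {\<iota> Y \<odot>\<^bsub>K\<^esub> amap \<pi> c | c Y. c \<in> hom D X Y \<and> amap p c = d}"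
      if "d \<in> hom E (omap p X) e'" "X \<in> Obj D" for d X e'
      using m homD[OF that(1)] that(2) unfolding G_def by auto
  qed
  then show ?thesis by blast
qed

theorem theorem3p14:
  fixes D :: "('d, 'da) category" and E :: "('e, 'ea) category"
    and p :: "('d, 'da, 'e, 'ea) cat_map"
    and K :: "('o, 'a) ocategory" and J :: "('o, 'a) category"
  assumes "small_category TYPE('s) D" and "small_category TYPE('s) E"
    and "cat_functor D E p"
    and "ordered_category K"
    and "subcategory J K" and "Obj J = Obj K"
    and "has_small_coproducts TYPE('s) J" and "has_small_coproducts TYPE('s) K"
    and "inclusion_preserves_small_coproducts TYPE('s) J K"
    and "sup_enriched_category K"
    and "cotupling_preserves_sups TYPE('s) K"
  shows "has_left_two_adjoint (lax_functor_category D K J) (lax_functor_category E K J)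
           (change_of_base D p)"
proof -
  interpret JK: ordered_wide_subcategory J K
    using assms(4-6) by (simp add: ordered_wide_subcategory_def ordered_wide_subcategory_axioms_def)
  show ?thesis
  proof (rule has_left_two_adjointI[OF JK.ordered_functor_change_of_base[OF assms(3)]], goal_cases)
    case (1 \<pi>)
    then have \<pi>: "\<pi> \<in> lax_functors D K" by simp
    \<comment> \<open>Smallness concerns only the index sets of these coproducts: a fibre is a
      subset of \<open>Obj D\<close> and inherits its injection into \<open>'s\<close>.\<close>
    have "\<exists>S \<iota>. ordered_coproduct J K {X\<in>Obj D. omap p X = e} (omap \<pi>) S \<iota>" for e
    proof (rule ordered_coproduct_exists[OF _ assms(7,9-11)])
      show "small TYPE('s) {X\<in>Obj D. omap p X = e}"
        using assms(1) by (auto simp: small_category_def small_def intro: inj_on_subset)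
      show "omap \<pi> X \<in> Obj J" if "X \<in> {X\<in>Obj D. omap p X = e}" for X
        using lax_functor.omap_Obj[OF lax_functorsD(1)[OF \<pi>]] that assms(6) by simp
    qed
    then obtain S \<iota> m where "left_kan_extension J K D E p \<pi> S \<iota> m"
      using JK.left_kan_extension_exists[OF assms(10,3) \<pi>] by blast
    then interpret left_kan_extension J K D E p \<pi> S \<iota> m .
    have [simp]: "omap (change_of_base D p) \<rho> = precompose D p \<rho>" for \<rho> :: "('e, 'ea, 'o, 'a) cat_map"
      by (simp add: change_of_base_def)
    show ?case
    proof (intro exI conjI ballI impI)
      show "kan \<in> Obj (lax_functor_category E K J)" using kan_lax by simp
      show "unit \<in> hom (lax_functor_category D K J) \<pi> (omap (change_of_base D p) kan)"
        using unit_hom by simp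
    qed (use transpose_exists transpose_reflects_order in simp_all)
  qed
qed

end
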